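(* Let $k=k(n)$ satisfy $k\to\infty$ and $k=o(n^{1/3})$ as $n\to\infty$. Then almost all connected graphs with $n$ vertices and $n+k$ edges are triangle-free, i.e. $$\lim_{n\to\infty}\frac{c_{C_3}(n,n+k)}{c(n,n+k)}=1.$$
   Context: $c(n,m)$ is the number of connected simple graphs on vertex set $\{1,\dots,n\}$ with $m$ edges, and $c_{C_3}(n,m)$ is the number of those containing no triangle (3-cycle) as a subgraph. *)

theory Defs
  imports Complex_Main "HOL-Library.Landau_Symbols"
begin

text \<open>
  A simple graph on the vertex set \<open>{1..n}\<close> is identified with its edge set, a set of
  two-element subsets of \<open>{1..n}\<close>.
\<close>

definition simple_graph :: "nat \<Rightarrow> nat set set \<Rightarrow> bool" where
  "simple_graph n E \<longleftrightarrow> (\<forall>e\<in>E. e \<subseteq> {1..n} \<and> card e = 2)"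

definition connected_graph :: "nat \<Rightarrow> nat set set \<Rightarrow> bool" where
  "connected_graph n E \<longleftrightarrow> (\<forall>u\<in>{1..n}. \<forall>v\<in>{1..n}. (u, v) \<in> {(x, y). {x, y} \<in> E}\<^sup>*)"

definition triangle_free :: "nat set set \<Rightarrow> bool" where
  "triangle_free E \<longleftrightarrow>
     \<not> (\<exists>x y z. x \<noteq> y \<and> y \<noteq> z \<and> x \<noteq> z \<and> {x, y} \<in> E \<and> {y, z} \<in> E \<and> {x, z} \<in> E)"

definition num_conn :: "nat \<Rightarrow> nat \<Rightarrow> nat" where
  "num_conn n m = card {E. simple_graph n E \<and> connected_graph n E \<and> card E = m}"

definition num_conn_triangle_free :: "nat \<Rightarrow> nat \<Rightarrow> nat" where
  "num_conn_triangle_free n m =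
     card {E. simple_graph n E \<and> connected_graph n E \<and> card E = m \<and> triangle_free E}"

end

theory Submission
  imports Defs
begin

text \<open>
  Write \<open>c\<^sub>m\<close> for the number of connected graphs with \<open>m\<close> edges on \<open>n\<close> vertices, \<open>m = n + k\<close>.
  All estimates are by switchings.

  \<^item> Graphs with a triangle \<open>xyz\<close>. If removing \<open>xy\<close> and \<open>xz\<close> leaves the graph connected, it is
    determined by a connected graph with \<open>m - 2\<close> edges, one of its edges \<open>yz\<close> and a vertex \<open>x\<close>.
    Otherwise the three sides hanging off the triangle are disjoint, so some \<open>x\<close> has a side with at most
    \<open>n / 2\<close> vertices, and this side can be rehung by an edge \<open>xw\<close> in at least \<open>n / 2\<close> ways. Together
    this bounds the number of graphs with a triangle by \<open>O(n c\<^bsub>m-1\<^esub>)\<close>.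
  \<^item> Adding an edge between two vertices at distance less than \<open>D\<close> closes a cycle of length at most \<open>D\<close>;
    a connected graph with \<open>m\<close> edges has at most \<open>D (k + 1)\<close> edges on such cycles, since one can
    successively delete one edge per cycle. So if most pairs of vertices are at distance less than \<open>D\<close>,
    then \<open>n\<^sup>2 c\<^bsub>m-1\<^esub> = O(D k c\<^sub>m)\<close>.
  \<^item> Most pairs are close: on a geodesic \<open>p\<^sub>0 \<dots> p\<^sub>d\<close> all but \<open>2k\<close> vertices are exclusive, that is, connected
    to no other vertex of the geodesic by edges off it. Whenever \<open>p\<^bsub>i+1\<^esub>, \<dots>, p\<^sub>j\<close> are exclusive, replace
    \<open>p\<^sub>i p\<^bsub>i+1\<^esub>\<close> by \<open>p\<^sub>i p\<^sub>j\<close>. There are of order \<open>d\<^sup>2 / k\<close> choices, and the graph is recovered from the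
    endpoints and \<open>c = p\<^bsub>i+1\<^esub>\<close>: geodesics from \<open>c\<close> to both ends agree up to \<open>p\<^sub>j\<close> and then part, the
    first one going to \<open>p\<^sub>i\<close>. So pairs at distance at least \<open>D\<close> are rare once \<open>D\<^sup>2 / k\<close> exceeds a
    large multiple of \<open>n\<close>.

  With \<open>D\<close> of order \<open>\<surd>(n k)\<close> the proportion of graphs with a triangle is \<open>O(\<surd>(k\<^sup>3 / n))\<close>.
\<close>

subsection \<open>Walks and geodesics\<close>

definition adj :: "'a set set \<Rightarrow> 'a rel" where
  "adj E = {(x, y). {x, y} \<in> E}"

lemma adj_iff [simp]: "(x, y) \<in> adj E \<longleftrightarrow> {x, y} \<in> E"
  by (simp add: adj_def)

lemma sym_adj: "sym (adj E)"
  by (auto simp: sym_def insert_commute)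

lemma adj_rtrancl_commute: "(x, y) \<in> (adj E)\<^sup>* \<Longrightarrow> (y, x) \<in> (adj E)\<^sup>*"
  by (meson sym_adj sym_rtrancl symD)

lemma adj_rtrancl_mono: "(x, y) \<in> (adj E)\<^sup>* \<Longrightarrow> E \<subseteq> F \<Longrightarrow> (x, y) \<in> (adj F)\<^sup>*"
  by (rule subsetD[OF rtrancl_mono]) (auto simp: adj_def)

lemma adj_relpow_commute: "(x, y) \<in> adj E ^^ l \<Longrightarrow> (y, x) \<in> adj E ^^ l"
proof (induction l arbitrary: y)
  case (Suc l)
  then obtain z where "(x, z) \<in> adj E ^^ l" "{y, z} \<in> E"
    by (auto simp: insert_commute)
  then show ?case
    using Suc.IH[of z] by (meson adj_iff relpow_Suc_I2)
qed auto

lemma adj_rtrancl_replace: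
  assumes "(x, y) \<in> (adj E)\<^sup>*"
    and "\<And>a b. {a, b} \<in> E \<Longrightarrow> (a, b) \<in> (adj F)\<^sup>*"
  shows "(x, y) \<in> (adj F)\<^sup>*"
  using assms(1)
proof induction
  case (step b c)
  then show ?case using assms(2)[of b c] by (meson adj_iff rtrancl_trans)
qed auto

lemma walk_relpow:
  assumes "\<And>l. i \<le> l \<Longrightarrow> l < j \<Longrightarrow> {f l, f (Suc l)} \<in> E" and "i \<le> j"
  shows "(f i, f j) \<in> adj E ^^ (j - i)"
  unfolding relpow_fun_conv
  by (rule exI[of _ "\<lambda>l. f (i + l)"]) (use assms in auto)

text \<open>Each vertex outside \<open>R\<close> is charged the first edge of a shortest path to \<open>R\<close>.\<close>

lemma card_le_roots_plus_edges:
  assumes fin: "finite V" "finite E" and RV: "R \<subseteq> V"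
    and reach: "\<And>v. v \<in> V \<Longrightarrow> \<exists>r\<in>R. (r, v) \<in> (adj E)\<^sup>*"
  shows "card V \<le> card R + card E"
proof -
  define \<delta> where "\<delta> v = (LEAST l. \<exists>r\<in>R. (r, v) \<in> adj E ^^ l)" for v
  have "\<exists>w. {w, v} \<in> E \<and> \<delta> w < \<delta> v" if v: "v \<in> V - R" for v
  proof -
    have "\<exists>l. \<exists>r\<in>R. (r, v) \<in> adj E ^^ l"
      using reach[of v] v by (meson DiffD1 rtrancl_imp_relpow)
    then have "\<exists>r\<in>R. (r, v) \<in> adj E ^^ \<delta> v"
      unfolding \<delta>_def by (rule LeastI_ex)
    then obtain r where r: "r \<in> R" "(r, v) \<in> adj E ^^ \<delta> v" by blast
    with v obtain l where l: "\<delta> v = Suc l" by (cases "\<delta> v") auto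
    with r obtain w where w: "(r, w) \<in> adj E ^^ l" "{w, v} \<in> E" by auto
    from w r have "\<delta> w \<le> l" unfolding \<delta>_def by (intro Least_le) blast
    with w l show ?thesis by auto
  qed
  then obtain par where par: "\<And>v. v \<in> V - R \<Longrightarrow> {par v, v} \<in> E \<and> \<delta> (par v) < \<delta> v"
    by metis
  \<comment> \<open>Two vertices sharing an edge would be parents of each other, and
    \<open>\<delta>\<close> would decrease in both directions.\<close>
  have "inj_on (\<lambda>v. {par v, v}) (V - R)"
    by (rule inj_onI) (metis par doubleton_eq_iff less_asym)
  then have "card (V - R) \<le> card E"
    by (rule card_inj_on_le) (use par fin in auto)
  then show ?thesis
    using card_Diff_subset[of R V] finite_subset[OF RV] fin RV by auto
qed

section \<open>Distances and a fixed choice of geodesics\<close>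

definition gdist :: "'a set set \<Rightarrow> 'a \<Rightarrow> 'a \<Rightarrow> nat" where
  "gdist E u v = (LEAST l. (u, v) \<in> adj E ^^ l)"

definition geodesic :: "'a set set \<Rightarrow> (nat \<Rightarrow> 'a) \<Rightarrow> nat \<Rightarrow> bool" where
  "geodesic E p d \<longleftrightarrow> (\<forall>l<d. {p l, p (Suc l)} \<in> E) \<and> (\<forall>l. (p 0, p d) \<in> adj E ^^ l \<longrightarrow> d \<le> l)"

text \<open>The path depends only on the graph and its two ends, so encoding and decoding of a
  switching refer to the same geodesic.\<close>

definition geo :: "'a set set \<Rightarrow> 'a \<Rightarrow> 'a \<Rightarrow> nat \<Rightarrow> 'a" where
  "geo E u v = (SOME p. p 0 = u \<and> p (gdist E u v) = v \<and> geodesic E p (gdist E u v))"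

lemma gdist_relpow: "(u, v) \<in> (adj E)\<^sup>* \<Longrightarrow> (u, v) \<in> adj E ^^ gdist E u v"
  unfolding gdist_def by (rule LeastI_ex) (rule rtrancl_imp_relpow)

lemma gdist_le: "(u, v) \<in> adj E ^^ l \<Longrightarrow> gdist E u v \<le> l"
  unfolding gdist_def by (rule Least_le)

lemma geo:
  assumes "(u, v) \<in> (adj E)\<^sup>*"
  shows "geo E u v 0 = u" "geo E u v (gdist E u v) = v" "geodesic E (geo E u v) (gdist E u v)"
proof -
  from gdist_relpow[OF assms] obtain p where
    "p 0 = u" "p (gdist E u v) = v" "\<forall>l<gdist E u v. {p l, p (Suc l)} \<in> E"
    unfolding relpow_fun_conv by auto
  then have "\<exists>p. p 0 = u \<and> p (gdist E u v) = v \<and> geodesic E p (gdist E u v)"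
    by (auto simp: geodesic_def gdist_le)
  from someI_ex[OF this] show "geo E u v 0 = u" "geo E u v (gdist E u v) = v"
    "geodesic E (geo E u v) (gdist E u v)"
    by (simp_all add: geo_def)
qed

lemma geodesic_edge: "geodesic E p d \<Longrightarrow> l < d \<Longrightarrow> {p l, p (Suc l)} \<in> E"
  by (simp add: geodesic_def)

lemma geodesic_le: "geodesic E p d \<Longrightarrow> (p 0, p d) \<in> adj E ^^ l \<Longrightarrow> d \<le> l"
  by (simp add: geodesic_def)

lemma geodesic_relpow: "geodesic E p d \<Longrightarrow> i \<le> j \<Longrightarrow> j \<le> d \<Longrightarrow> (p i, p j) \<in> adj E ^^ (j - i)"
  by (rule walk_relpow) (auto simp: geodesic_def)

lemma geodesic_le_to_start:
  assumes g: "geodesic E p d" and j: "j \<le> d" and l: "(p j, p 0) \<in> adj E ^^ l"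
  shows "j \<le> l"
proof -
  have "(p 0, p d) \<in> adj E ^^ (l + (d - j))"
    unfolding relpow_add using adj_relpow_commute[OF l] geodesic_relpow[OF g j order_refl] by auto
  from geodesic_le[OF g this] j show ?thesis by simp
qed

lemma geodesic_le_to_end:
  assumes g: "geodesic E p d" and j: "j \<le> d" and l: "(p j, p d) \<in> adj E ^^ l"
  shows "d - j \<le> l"
proof -
  have "(p 0, p d) \<in> adj E ^^ (j + l)"
    unfolding relpow_add using l geodesic_relpow[OF g _ j, of 0] by auto
  from geodesic_le[OF g this] j show ?thesis by simp
qed

lemma geodesic_inj: "geodesic E p d \<Longrightarrow> inj_on p {..d}"
proof (rule linorder_inj_onI)
  fix i j assume g: "geodesic E p d" and ij: "i < j" "i \<in> {..d}" "j \<in> {..d}"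
  show "p i \<noteq> p j"
  proof
    assume "p i = p j"
    then have "(p j, p 0) \<in> adj E ^^ i"
      using adj_relpow_commute[OF geodesic_relpow[OF g, of 0 i]] ij by auto
    from geodesic_le_to_start[OF g _ this] ij show False by auto
  qed
qed auto

subsection \<open>Shortcuts of geodesics\<close>

definition off_path :: "'a set set \<Rightarrow> (nat \<Rightarrow> 'a) \<Rightarrow> nat \<Rightarrow> 'a set set" where
  "off_path E p d = E - (\<lambda>i. {p i, p (Suc i)}) ` {..<d}"

definition exclusive :: "'a set set \<Rightarrow> (nat \<Rightarrow> 'a) \<Rightarrow> nat \<Rightarrow> nat \<Rightarrow> bool" where
  "exclusive E p d l \<longleftrightarrow> (\<forall>m\<le>d. (p l, p m) \<in> (adj (off_path E p d))\<^sup>* \<longrightarrow> m = l)"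

text \<open>Let \<open>R\<close> hold the first index of each off-path component meeting the path.
  These roots reach all of \<open>V\<close> without path edges, so counting edges leaves at most
  \<open>card E - card V + 1\<close> indices outside \<open>R\<close>. A non-exclusive index in
  \<open>R\<close> is paired with an index outside \<open>R\<close> of its own component, which at
  most doubles this number.\<close>

lemma card_not_exclusive:
  assumes fin: "finite V" "finite E" and inj: "inj_on p {..d}" and pV: "p ` {..d} \<subseteq> V"
    and pE: "\<And>l. l < d \<Longrightarrow> {p l, p (Suc l)} \<in> E"
    and conn: "\<And>v. v \<in> V \<Longrightarrow> (p 0, v) \<in> (adj E)\<^sup>*"
  shows "card {l. l \<le> d \<and> \<not> exclusive E p d l} + 2 * card V \<le> 2 * card E + 2"
proof -
  let ?O = "off_path E p d"
  define R where "R = {l. l \<le> d \<and> (\<forall>m<l. (p m, p l) \<notin> (adj ?O)\<^sup>*)}"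
  have finO: "finite ?O" unfolding off_path_def using fin by simp
  have injE: "inj_on (\<lambda>i. {p i, p (Suc i)}) {..<d}"
  proof (rule inj_onI)
    fix x y assume xy: "x \<in> {..<d}" "y \<in> {..<d}" "{p x, p (Suc x)} = {p y, p (Suc y)}"
    then consider "p x = p y" | "p x = p (Suc y)" "p (Suc x) = p y"
      by (auto simp: doubleton_eq_iff)
    then show "x = y"
    proof cases
      case 1 with xy inj_onD[OF inj, of x y] show ?thesis by auto
    next
      case 2 with xy inj_onD[OF inj, of x "Suc y"] inj_onD[OF inj, of "Suc x" y] show ?thesis by auto
    qed
  qed
  have "card ((\<lambda>i. {p i, p (Suc i)}) ` {..<d}) = d"
    by (simp add: card_image injE)
  moreover have sub: "(\<lambda>i. {p i, p (Suc i)}) ` {..<d} \<subseteq> E" using pE by auto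
  ultimately have cO: "card ?O + d = card E"
    unfolding off_path_def using card_Diff_subset[OF _ sub] card_mono[OF fin(2) sub] by auto
  have reach: "\<exists>r\<in>p ` R. (r, v) \<in> (adj ?O)\<^sup>*" if "v \<in> V" for v
  proof -
    \<comment> \<open>Follow a walk from \<open>p 0\<close>: a step along a path edge ends on the
      path, and that path vertex becomes the new origin.\<close>
    from conn[OF that] have "\<exists>m\<le>d. (p m, v) \<in> (adj ?O)\<^sup>*"
    proof induction
      case (step b c)
      then show ?case
      proof (cases "{b, c} \<in> ?O")
        case True with step show ?thesis by (meson adj_iff rtrancl.rtrancl_into_rtrancl)
      next
        case False
        with step have "c \<in> p ` {..d}"
          by (auto simp: off_path_def doubleton_eq_iff)
        then show ?thesis by auto
      qed
    qed auto
    then obtain m where m: "m \<le> d" "(p m, v) \<in> (adj ?O)\<^sup>*" by blast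
    define l where "l = (LEAST l. (p l, v) \<in> (adj ?O)\<^sup>*)"
    have l: "(p l, v) \<in> (adj ?O)\<^sup>*" unfolding l_def by (rule LeastI) (rule m)
    have "l \<le> d" using m Least_le[of "\<lambda>l. (p l, v) \<in> (adj ?O)\<^sup>*" m] unfolding l_def by auto
    moreover have "(p q, p l) \<notin> (adj ?O)\<^sup>*" if "q < l" for q
      using not_less_Least[of q "\<lambda>l. (p l, v) \<in> (adj ?O)\<^sup>*"] that l unfolding l_def
      by (meson rtrancl_trans)
    ultimately have "l \<in> R" by (auto simp: R_def)
    with l show ?thesis by blast
  qed
  have Rd: "R \<subseteq> {..d}" by (auto simp: R_def)
  have "card V \<le> card (p ` R) + card ?O"
    by (rule card_le_roots_plus_edges) (use fin finO reach Rd pV in auto)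
  moreover have "card (p ` R) = card R"
    by (intro card_image inj_on_subset[OF inj Rd])
  ultimately have VR: "card V + d \<le> card R + card E" using cO by simp
  let ?N = "{..d} - R"
  have cN: "card ?N + card R = d + 1"
    using card_Diff_subset[of R "{..d}"] finite_subset[OF Rd] Rd card_mono[OF _ Rd] by auto
  let ?P = "{l \<in> R. \<not> exclusive E p d l}"
  have "\<exists>m. m \<in> ?N \<and> (p l, p m) \<in> (adj ?O)\<^sup>*" if "l \<in> ?P" for l
  proof -
    from that obtain m where m: "m \<le> d" "m \<noteq> l" "(p l, p m) \<in> (adj ?O)\<^sup>*"
      by (auto simp: exclusive_def)
    have "\<not> m < l" using that m adj_rtrancl_commute by (fastforce simp: R_def)
    with m have "l < m" by simp
    with m have "m \<in> ?N" by (auto simp: R_def)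
    with m show ?thesis by blast
  qed
  then obtain h where h: "\<And>l. l \<in> ?P \<Longrightarrow> h l \<in> ?N \<and> (p l, p (h l)) \<in> (adj ?O)\<^sup>*" by metis
  \<comment> \<open>Distinct members of \<open>R\<close> lie in distinct off-path components, hence
    so do their partners.\<close>
  have "inj_on h ?P"
  proof (rule linorder_inj_onI)
    fix x y assume xy: "x < y" "x \<in> ?P" "y \<in> ?P"
    show "h x \<noteq> h y"
    proof
      assume "h x = h y"
      then have "(p x, p y) \<in> (adj ?O)\<^sup>*"
        using h[OF xy(2)] h[OF xy(3)] adj_rtrancl_commute by (metis rtrancl_trans)
      with xy show False by (auto simp: R_def)
    qed
  qed auto
  then have "card ?P \<le> card ?N"
    by (rule card_inj_on_le) (use h in auto)
  moreover have "card {l. l \<le> d \<and> \<not> exclusive E p d l} \<le> card (?N \<union> ?P)"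
    by (rule card_mono) (use finite_subset[OF Rd] in auto)
  moreover have "card (?N \<union> ?P) \<le> card ?N + card ?P" by (rule card_Un_le)
  ultimately show ?thesis using VR cN by linarith
qed

section \<open>Replacing a path edge by a chord\<close>

definition shortcut :: "'a set set \<Rightarrow> (nat \<Rightarrow> 'a) \<Rightarrow> nat \<Rightarrow> nat \<Rightarrow> 'a set set" where
  "shortcut E p i j = insert {p i, p j} (E - {{p i, p (Suc i)}})"

text \<open>The bound \<open>j < d\<close> provides the vertex \<open>p (Suc j)\<close> through
  which a geodesic towards \<open>p d\<close> leaves the window, and \<open>Suc i < j\<close> keeps
  the chord from being a path edge. The vertex \<open>p i\<close> itself may be
  non-exclusive.\<close>

locale exclusive_window =
  fixes E :: "'a set set" and p :: "nat \<Rightarrow> 'a" and d i j :: nat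
  assumes geod: "geodesic E p d"
    and ij: "Suc i < j" and jd: "j < d"
    and excl: "\<And>l. i < l \<Longrightarrow> l \<le> j \<Longrightarrow> exclusive E p d l"
begin

abbreviation "E' \<equiv> shortcut E p i j"

lemma p_eq_iff: "l \<le> d \<Longrightarrow> m \<le> d \<Longrightarrow> p l = p m \<longleftrightarrow> l = m"
  using geodesic_inj[OF geod] by (auto simp: inj_on_def)

text \<open>Such an edge would lie off the path and join \<open>p j\<close> to \<open>p i\<close>,
  against exclusivity of \<open>p j\<close>.\<close>

lemma chord_not_edge: "{p i, p j} \<notin> E"
proof
  assume e: "{p i, p j} \<in> E"
  have "{p i, p j} \<noteq> {p l, p (Suc l)}" if "l < d" for l
    using that ij jd by (auto simp: doubleton_eq_iff p_eq_iff)
  with e have "{p j, p i} \<in> off_path E p d"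
    by (auto simp: off_path_def insert_commute)
  then have "(p j, p i) \<in> (adj (off_path E p d))\<^sup>*" by auto
  moreover have "i \<le> d" "i \<noteq> j" "i < j" using ij jd by auto
  ultimately show False using excl[of j] unfolding exclusive_def by blast
qed

lemma card_shortcut: "finite E \<Longrightarrow> card E' = card E"
  using chord_not_edge geodesic_edge[OF geod, of i] ij jd
  by (auto simp: shortcut_def card_Diff_singleton_if card_gt_0_iff intro!: Suc_pred)

lemma shortcut_inverse: "E = insert {p i, p (Suc i)} (E' - {{p i, p j}})"
  using chord_not_edge geodesic_edge[OF geod, of i] ij jd
  by (auto simp: shortcut_def)

lemma shortcut_edge: "i < l \<Longrightarrow> l < d \<Longrightarrow> {p l, p (Suc l)} \<in> E'"
  using geodesic_edge[OF geod, of l] ij jd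
  by (auto simp: shortcut_def doubleton_eq_iff p_eq_iff)

lemma shortcut_edge': "l < i \<Longrightarrow> {p l, p (Suc l)} \<in> E'"
  using geodesic_edge[OF geod, of l] ij jd
  by (auto simp: shortcut_def doubleton_eq_iff p_eq_iff)

lemma relpow_Suc_i_j: "(p (Suc i), p j) \<in> adj E' ^^ (j - Suc i)"
  by (rule walk_relpow) (use ij jd in \<open>auto intro: shortcut_edge\<close>)

text \<open>The deleted edge is bypassed by walking from \<open>p (Suc i)\<close> up to
  \<open>p j\<close> and then along the chord.\<close>

lemma shortcut_connected:
  assumes "(x, y) \<in> (adj E)\<^sup>*"
  shows "(x, y) \<in> (adj E')\<^sup>*"
proof (rule adj_rtrancl_replace[OF assms])
  fix a b assume ab: "{a, b} \<in> E"
  have *: "(p (Suc i), p i) \<in> (adj E')\<^sup>*"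
    using relpow_imp_rtrancl[OF relpow_Suc_i_j]
    by (rule rtrancl.rtrancl_into_rtrancl) (simp add: shortcut_def insert_commute)
  show "(a, b) \<in> (adj E')\<^sup>*"
  proof (cases "{a, b} = {p i, p (Suc i)}")
    case True
    with * adj_rtrancl_commute[OF *] show ?thesis by (auto simp: doubleton_eq_iff)
  next
    case False
    with ab have "(a, b) \<in> adj E'" by (simp add: shortcut_def)
    then show ?thesis by (rule r_into_rtrancl)
  qed
qed

lemma off_path_edge_or_path:
  assumes "{x, y} \<in> E'"
  shows "{x, y} \<in> off_path E p d \<or> {x, y} = {p i, p j} \<or> (\<exists>l<d. l \<noteq> i \<and> {x, y} = {p l, p (Suc l)})"
  using assms by (auto simp: off_path_def shortcut_def)

text \<open>A simple path that enters the part hanging off \<open>p l\<close> can leave it only through \<open>p l\<close>.\<close>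

lemma next_not_off_path:
  assumes l: "i < l" "l \<le> j"
    and g: "geodesic E' f e" and s: "s < e" "f s = p l" and fe: "f e = p m" "m \<le> d" "m \<noteq> l"
  shows "{f s, f (Suc s)} \<notin> off_path E p d"
proof
  let ?K = "{x. (p l, x) \<in> (adj (off_path E p d))\<^sup>*}"
  assume "{f s, f (Suc s)} \<in> off_path E p d"
  then have 1: "f (Suc s) \<in> ?K" using s by auto
  have 2: "f e \<notin> ?K" using excl[OF l] fe by (auto simp: exclusive_def)
  \<comment> \<open>Leaving \<open>?K\<close> needs the chord or a path edge, hence a path vertex
    inside \<open>?K\<close>. By exclusivity this is \<open>p l = f s\<close>, which a geodesic does
    not revisit.\<close>
  have "f t \<in> ?K" if "Suc s \<le> t" "t \<le> e" for t
    using that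
  proof (induction t rule: dec_induct)
    case (step t)
    then have t: "f t \<in> ?K" "{f t, f (Suc t)} \<in> E'" using geodesic_edge[OF g, of t] by auto
    show ?case
    proof (rule ccontr)
      assume n: "f (Suc t) \<notin> ?K"
      with t have "{f t, f (Suc t)} \<notin> off_path E p d"
        by (auto intro: rtrancl.rtrancl_into_rtrancl)
      with off_path_edge_or_path[OF t(2)] ij jd obtain q where q: "q \<le> d" "f t = p q"
        by (metis doubleton_eq_iff Suc_leI Suc_lessD less_imp_le less_trans)
      with t excl[OF l] have "q = l" by (auto simp: exclusive_def)
      with q s have "f t = f s" by simp
      moreover have "f t \<noteq> f s"
        using inj_onD[OF geodesic_inj[OF g], of t s] step.hyps step.prems s by auto
      ultimately show False by simp
    qed
  qed (use 1 in auto)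
  from this[of e] s 2 show False by auto
qed

text \<open>Before \<open>p j\<close>, off-path edges are dead ends, the edge to \<open>p i\<close>
  is deleted, the chord is out of reach, and turning back would repeat a vertex. Only the next path
  vertex remains.\<close>

lemma geodesic_prefix:
  assumes g: "geodesic E' f e" and f0: "f 0 = p (Suc i)" and fe: "f e = p m" "m \<le> d" "m \<le> i \<or> j < m"
    and "s < j - i"
  shows "s < e \<and> f s = p (Suc i + s)"
proof -
  have "s < e \<and> (\<forall>t\<le>s. f t = p (Suc i + t))"
    using \<open>s < j - i\<close>
  proof (induction s)
    case 0
    have "e \<noteq> 0"
    proof
      assume "e = 0"
      then have "p (Suc i) = p m" using f0 fe by simp
      then have "m = Suc i" using fe ij jd by (subst (asm) p_eq_iff) auto
      then show False using fe ij by auto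
    qed
    then show ?case using f0 by simp
  next
    case (Suc s)
    let ?l = "Suc i + s"
    have s: "s < e" "f s = p ?l" using Suc by auto
    have "{f s, f (Suc s)} \<notin> off_path E p d"
      by (rule next_not_off_path[OF _ _ g s fe(1,2)]) (use fe(3) Suc.prems ij in auto)
    with off_path_edge_or_path[OF geodesic_edge[OF g s(1)]] Suc.prems ij jd
    obtain q where q: "q < d" "q \<noteq> i" "{f s, f (Suc s)} = {p q, p (Suc q)}"
      by (auto simp: s doubleton_eq_iff p_eq_iff)
    have "f (Suc s) = p (Suc ?l)"
    proof (rule ccontr)
      assume "f (Suc s) \<noteq> p (Suc ?l)"
      with q s have q': "Suc q = ?l" "f (Suc s) = p q"
        using Suc.prems ij jd by (auto simp: doubleton_eq_iff p_eq_iff)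
      with q obtain r where r: "s = Suc r" by (cases s) auto
      have "f r = p (Suc i + r)" using Suc.IH Suc.prems r by simp
      moreover have "f (Suc s) = p (Suc i + r)" using q' r by simp
      moreover have "f r \<noteq> f (Suc s)"
        using inj_onD[OF geodesic_inj[OF g], of r "Suc s"] s r by auto
      ultimately show False by simp
    qed
    moreover have "Suc s \<noteq> e"
    proof
      assume "Suc s = e"
      then have "p (Suc ?l) = p m" using calculation fe by simp
      then have "m = Suc ?l" using fe Suc.prems jd by (subst (asm) p_eq_iff) auto
      then show False using fe Suc.prems by auto
    qed
    ultimately show ?case using s Suc by (auto simp: le_Suc_eq)
  qed
  then show ?thesis by simp
qed

text \<open>The vertex \<open>p j\<close> is reached at time \<open>j - i - 1\<close>; from there
  only the chord and the path edge ahead are possible. Since \<open>f\<close> never returns to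
  \<open>p j\<close>, the rest of it avoids the chord and is a walk in \<open>E\<close>.\<close>

lemma geodesic_next:
  assumes g: "geodesic E' f e" and f0: "f 0 = p (Suc i)" and fe: "f e = p m" "m \<le> d" "m \<le> i \<or> j < m"
  shows "f (j - i) = p i \<or> f (j - i) = p (Suc j)"
    and "(f (j - i), f e) \<in> adj E ^^ (e - (j - i))"
    and "j - i \<le> e"
proof -
  define s where "s = j - Suc i"
  have s: "j - i = Suc s" "Suc i + s = j" "s < j - i" "s \<noteq> 0" using ij by (auto simp: s_def)
  from geodesic_prefix[OF g f0 fe s(3)] s have fs: "s < e" "f s = p j" by auto
  show "j - i \<le> e" using fs s by simp
  have "{f s, f (Suc s)} \<notin> off_path E p d"
    by (rule next_not_off_path[OF _ _ g fs fe(1,2)]) (use fe(3) ij in auto)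
  with off_path_edge_or_path[OF geodesic_edge[OF g fs(1)]] ij jd
  have "f (Suc s) = p i \<or> f (Suc s) = p (Suc j) \<or> f (Suc s) = p (j - 1)"
    by (auto simp: fs doubleton_eq_iff p_eq_iff)
  moreover have "f (Suc s) \<noteq> p (j - 1)"
  proof -
    have "f (s - 1) = p (j - 1)"
      using geodesic_prefix[OF g f0 fe, of "s - 1"] s by auto
    moreover have "f (s - 1) \<noteq> f (Suc s)"
      using inj_onD[OF geodesic_inj[OF g], of "s - 1" "Suc s"] fs by fastforce
    ultimately show ?thesis by simp
  qed
  ultimately show "f (j - i) = p i \<or> f (j - i) = p (Suc j)" using s by simp
  show "(f (j - i), f e) \<in> adj E ^^ (e - (j - i))"
  proof (rule walk_relpow)
    fix t assume t: "j - i \<le> t" "t < e"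
    have "f t \<noteq> f s" "f (Suc t) \<noteq> f s"
      using inj_onD[OF geodesic_inj[OF g], of t s] inj_onD[OF geodesic_inj[OF g], of "Suc t" s] t s
      by auto
    then have "{f t, f (Suc t)} \<noteq> {p i, p j}" using fs by (auto simp: doubleton_eq_iff)
    with geodesic_edge[OF g t(2)] show "{f t, f (Suc t)} \<in> E" by (auto simp: shortcut_def)
  qed (use fs s in auto)
qed

text \<open>Through \<open>p (Suc j)\<close> the rest alone would need at least \<open>Suc j\<close>
  steps, whereas the route over the chord has total length \<open>j\<close>.\<close>

lemma geodesic_to_start:
  assumes g: "geodesic E' f e" and f0: "f 0 = p (Suc i)" and fe: "f e = p 0"
  shows "f (j - i) = p i"
proof (rule ccontr)
  note n = geodesic_next[OF g f0 fe]
  assume "f (j - i) \<noteq> p i"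
  with n have "(p (Suc j), p 0) \<in> adj E ^^ (e - (j - i))" using fe by auto
  from geodesic_le_to_start[OF geod _ this] jd have 1: "Suc j \<le> e - (j - i)" by simp
  have "(p 0, p i) \<in> adj E' ^^ (i - 0)"
    by (rule walk_relpow) (use shortcut_edge' in auto)
  then have "(p i, p 0) \<in> adj E' ^^ i" using adj_relpow_commute by fastforce
  moreover have "(p j, p i) \<in> adj E' ^^ 1" by (simp add: shortcut_def insert_commute)
  ultimately have "(p (Suc i), p 0) \<in> adj E' ^^ ((j - Suc i) + (1 + i))"
    using relpow_Suc_i_j unfolding relpow_add by blast
  with geodesic_le[OF g] f0 fe ij have "e \<le> j" by force
  with 1 show False by simp
qed

text \<open>Over the chord the rest alone would need at least \<open>d - i\<close> steps, whereas
  the path itself takes \<open>d - Suc i\<close> in total.\<close>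

lemma geodesic_to_end:
  assumes g: "geodesic E' f e" and f0: "f 0 = p (Suc i)" and fe: "f e = p d"
  shows "f (j - i) = p (Suc j)"
proof (rule ccontr)
  note n = geodesic_next[OF g f0 fe]
  assume "f (j - i) \<noteq> p (Suc j)"
  with n have "(p i, p d) \<in> adj E ^^ (e - (j - i))" using fe jd by auto
  from geodesic_le_to_end[OF geod _ this] ij jd have 1: "d - i \<le> e - (j - i)" by simp
  have "(p (Suc i), p d) \<in> adj E' ^^ (d - Suc i)"
    by (rule walk_relpow) (use shortcut_edge ij jd in auto)
  with geodesic_le[OF g] f0 fe have "e \<le> d - Suc i" by simp
  with 1 ij jd show False by simp
qed

end

section \<open>Recovering the graph from its shortcut\<close>

definition divergence :: "(nat \<Rightarrow> 'a) \<Rightarrow> (nat \<Rightarrow> 'a) \<Rightarrow> nat" where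
  "divergence f g = (LEAST s. f s \<noteq> g s)"

text \<open>For \<open>c = p (Suc i)\<close> the geodesics part at time \<open>s = j - i\<close>,
  where \<open>f s = p i\<close> and \<open>f (s - 1) = p j\<close>. So the chord is deleted and the
  original path edge restored.\<close>

definition unshortcut :: "'a set set \<Rightarrow> 'a \<Rightarrow> 'a \<Rightarrow> 'a \<Rightarrow> 'a set set" where
  "unshortcut E u v c =
    (let f = geo E c u; s = divergence f (geo E c v)
     in insert {f s, c} (E - {{f s, f (s - 1)}}))"

context exclusive_window
begin

text \<open>Besides \<open>E\<close>, the window length and the vertex \<open>p i\<close> are read
  off the shortcut graph; injectivity of the encoding uses all three.\<close>

lemma unshortcut:
  assumes "\<And>x y. x \<in> p ` {..d} \<Longrightarrow> y \<in> p ` {..d} \<Longrightarrow> (x, y) \<in> (adj E)\<^sup>*"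
  defines "c \<equiv> p (Suc i)" and "f \<equiv> geo E' (p (Suc i)) (p 0)" and "g \<equiv> geo E' (p (Suc i)) (p d)"
  shows "divergence f g = j - i" "f (j - i) = p i" "unshortcut E' (p 0) (p d) c = E"
proof -
  have r: "(c, p 0) \<in> (adj E')\<^sup>*" "(c, p d) \<in> (adj E')\<^sup>*"
    by (rule shortcut_connected, rule assms(1); use ij jd in \<open>force simp: c_def\<close>)+
  note f = geo[OF r(1), unfolded c_def, folded f_def]
  note g = geo[OF r(2), unfolded c_def, folded g_def]
  note ff = geodesic_prefix[OF f(3,1,2)] and gg = geodesic_prefix[OF g(3,1,2)]
  have eq: "f s = p (Suc i + s)" "g s = p (Suc i + s)" if "s < j - i" for s
    using ff[of s] gg[of s] that jd by auto
  show fj: "f (j - i) = p i" by (rule geodesic_to_start[OF f(3,1,2)])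
  have gj: "g (j - i) = p (Suc j)" by (rule geodesic_to_end[OF g(3,1,2)])
  show dv: "divergence f g = j - i"
    unfolding divergence_def
  proof (rule Least_equality)
    show "f (j - i) \<noteq> g (j - i)" using fj gj ij jd by (simp add: p_eq_iff)
    show "j - i \<le> s" if "f s \<noteq> g s" for s using eq[of s] that by (metis not_le)
  qed
  have "f (j - i - 1) = p j" using eq(1)[of "j - i - 1"] ij by auto
  then show "unshortcut E' (p 0) (p d) c = E"
    using dv fj shortcut_inverse unfolding unshortcut_def f_def g_def c_def by (simp add: Let_def)
qed

end

subsection \<open>Pairs of distant vertices\<close>

definition conn_graphs :: "nat \<Rightarrow> nat \<Rightarrow> nat set set set" where
  "conn_graphs n m = {E. simple_graph n E \<and> connected_graph n E \<and> card E = m}"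

lemma finite_simple_graphs: "finite {E. simple_graph n E}"
  by (rule finite_subset[of _ "Pow (Pow {1..n})"]) (auto simp: simple_graph_def)

lemma finite_conn_graphs [simp]: "finite (conn_graphs n m)"
  by (rule finite_subset[OF _ finite_simple_graphs]) (auto simp: conn_graphs_def)

lemma connected_graph_iff:
  "connected_graph n E \<longleftrightarrow> (\<forall>u\<in>{1..n}. \<forall>v\<in>{1..n}. (u, v) \<in> (adj E)\<^sup>*)"
  by (simp add: connected_graph_def adj_def)

lemma simple_graph_finite: "simple_graph n E \<Longrightarrow> finite E"
  by (rule finite_subset[of _ "Pow {1..n}"]) (auto simp: simple_graph_def)

lemma conn_graphsD:
  assumes "E \<in> conn_graphs n m"
  shows "simple_graph n E" "card E = m" "finite E"
    "u \<in> {1..n} \<Longrightarrow> v \<in> {1..n} \<Longrightarrow> (u, v) \<in> (adj E)\<^sup>*"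
    "{u, v} \<in> E \<Longrightarrow> u \<in> {1..n}" "{u, v} \<in> E \<Longrightarrow> v \<in> {1..n}" "{u, v} \<in> E \<Longrightarrow> u \<noteq> v"
    "e \<in> E \<Longrightarrow> card e = 2" "e \<in> E \<Longrightarrow> e \<subseteq> {1..n}"
proof -
  show s: "simple_graph n E" "card E = m"
    and "u \<in> {1..n} \<Longrightarrow> v \<in> {1..n} \<Longrightarrow> (u, v) \<in> (adj E)\<^sup>*"
    using assms by (auto simp: conn_graphs_def connected_graph_iff)
  show "finite E" using s(1) by (rule simple_graph_finite)
  show "e \<in> E \<Longrightarrow> card e = 2" "e \<in> E \<Longrightarrow> e \<subseteq> {1..n}"
    "{u, v} \<in> E \<Longrightarrow> u \<in> {1..n}" "{u, v} \<in> E \<Longrightarrow> v \<in> {1..n}" "{u, v} \<in> E \<Longrightarrow> u \<noteq> v"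
    using s(1) by (force simp: simple_graph_def)+
qed

lemma geo_in_vertices:
  assumes E: "E \<in> conn_graphs n m" and uv: "u \<in> {1..n}" "v \<in> {1..n}" and l: "l \<le> gdist E u v"
  shows "geo E u v l \<in> {1..n}"
proof -
  note g = geo[OF conn_graphsD(4)[OF E uv]]
  show ?thesis
  proof (cases l)
    case 0 with g uv show ?thesis by simp
  next
    case (Suc k)
    with geodesic_edge[OF g(3), of k] l conn_graphsD(6)[OF E] show ?thesis by auto
  qed
qed

text \<open>A pair \<open>(g, i)\<close> stands for the window with \<open>j = i + g\<close>. The
  cap \<open>M\<close> on the length limits how many windows one non-exclusive index can
  spoil.\<close>

definition windows :: "nat set set \<Rightarrow> nat \<Rightarrow> nat \<Rightarrow> nat \<Rightarrow> (nat \<times> nat) set" where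
  "windows E u v M = (SIGMA g:{2..M}. {i. i + g < gdist E u v \<and>
     (\<forall>l\<in>{i<..i + g}. exclusive E (geo E u v) (gdist E u v) l)})"

lemma finite_windows [simp]: "finite (windows E u v M)"
  unfolding windows_def
  by (intro finite_SigmaI) (auto intro: finite_subset[of _ "{..gdist E u v}"])

text \<open>For each length \<open>g\<close>, each of the at most \<open>2 * q + 2\<close>
  non-exclusive indices spoils at most \<open>g\<close> starts, and \<open>g\<close> more run past
  the end. So at most \<open>M * (2 * q + 3)\<close> starts, half of the assumed distance, are
  lost.\<close>

lemma card_windows:
  assumes E: "E \<in> conn_graphs n (n + q)" and uv: "u \<in> {1..n}" "v \<in> {1..n}"
    and far: "2 * (M * (2 * q + 3)) \<le> gdist E u v"
  shows "(M - 1) * (M * (2 * q + 3)) \<le> card (windows E u v M)"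
proof -
  let ?d = "gdist E u v" and ?p = "geo E u v"
  let ?B = "{l. l \<le> ?d \<and> \<not> exclusive E ?p ?d l}"
  note g = geo[OF conn_graphsD(4)[OF E uv]]
  have "card ?B + 2 * card {1..n} \<le> 2 * card E + 2"
    by (rule card_not_exclusive)
       (use E uv g geodesic_inj[OF g(3)] geodesic_edge[OF g(3)] geo_in_vertices[OF E uv]
          conn_graphsD[OF E] in auto)
  then have B: "card ?B \<le> 2 * q + 2" using conn_graphsD(2)[OF E] by simp
  have I: "M * (2 * q + 3) \<le> card {i. i + g < ?d \<and> (\<forall>l\<in>{i<..i + g}. exclusive E ?p ?d l)}"
    (is "_ \<le> card ?I") if g: "g \<in> {2..M}" for g
  proof -
    have sub: "{..<?d - g} \<subseteq> ?I \<union> (\<Union>b\<in>?B. {b - g..<b})"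
    proof
      fix i assume i: "i \<in> {..<?d - g}"
      show "i \<in> ?I \<union> (\<Union>b\<in>?B. {b - g..<b})"
      proof (cases "i \<in> ?I")
        case False
        with i obtain l where "l \<in> {i<..i + g}" "\<not> exclusive E ?p ?d l" by auto
        with i have "l \<in> ?B" "i \<in> {l - g..<l}" by auto
        then show ?thesis by blast
      qed simp
    qed
    have finI: "finite ?I" by (rule finite_subset[of _ "{..?d}"]) auto
    have "?d - g \<le> card (?I \<union> (\<Union>b\<in>?B. {b - g..<b}))"
      using card_mono[OF _ sub] finI by simp
    also have "\<dots> \<le> card ?I + card (\<Union>b\<in>?B. {b - g..<b})" by (rule card_Un_le)
    also have "card (\<Union>b\<in>?B. {b - g..<b}) \<le> (\<Sum>b\<in>?B. card {b - g..<b})"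
      by (rule card_UN_le) simp
    also have "\<dots> \<le> (\<Sum>b\<in>?B. g)" by (rule sum_mono) simp
    also have "\<dots> = card ?B * g" by simp
    also have "\<dots> \<le> (2 * q + 2) * g" using B by (rule mult_le_mono1)
    finally have "?d \<le> card ?I + (2 * q + 3) * g" by (simp add: algebra_simps)
    moreover have "(2 * q + 3) * g \<le> M * (2 * q + 3)" using g by simp
    ultimately show ?thesis using far by linarith
  qed
  have "(M - 1) * (M * (2 * q + 3)) = (\<Sum>g\<in>{2..M}. M * (2 * q + 3))"
    by simp
  also have "\<dots> \<le> (\<Sum>g\<in>{2..M}. card {i. i + g < ?d \<and> (\<forall>l\<in>{i<..i + g}. exclusive E ?p ?d l)})"
    by (rule sum_mono) (rule I)
  also have "\<dots> = card (windows E u v M)"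
    unfolding windows_def
    by (subst card_SigmaI) (auto intro: finite_subset[of _ "{..?d}"])
  finally show ?thesis .
qed

definition far_pairs :: "nat \<Rightarrow> nat \<Rightarrow> nat \<Rightarrow> (nat set set \<times> nat \<times> nat) set" where
  "far_pairs n m D = {(E, u, v). E \<in> conn_graphs n m \<and> u \<in> {1..n} \<and> v \<in> {1..n} \<and> D \<le> gdist E u v}"

lemma finite_far_pairs: "finite (far_pairs n m D)"
  by (rule finite_subset[of _ "conn_graphs n m \<times> {1..n} \<times> {1..n}"]) (auto simp: far_pairs_def)

lemma windows_exclusive_window:
  assumes E: "E \<in> conn_graphs n m" and uv: "u \<in> {1..n}" "v \<in> {1..n}" and w: "(g, i) \<in> windows E u v M"
  shows "exclusive_window E (geo E u v) (gdist E u v) i (i + g)"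
  using w geo(3)[OF conn_graphsD(4)[OF E uv]]
  by unfold_locales (auto simp: windows_def)

lemma shortcut_in_conn_graphs:
  assumes E: "E \<in> conn_graphs n m" and uv: "u \<in> {1..n}" "v \<in> {1..n}" and w: "(g, i) \<in> windows E u v M"
  shows "shortcut E (geo E u v) i (i + g) \<in> conn_graphs n m"
proof -
  interpret exclusive_window E "geo E u v" "gdist E u v" i "i + g"
    by (rule windows_exclusive_window[OF E uv w])
  have "geo E u v i \<in> {1..n}" "geo E u v (i + g) \<in> {1..n}" "geo E u v i \<noteq> geo E u v (i + g)"
    using geo_in_vertices[OF E uv] ij jd by (auto simp: p_eq_iff)
  then have "simple_graph n E'"
    using conn_graphsD(1)[OF E] by (auto simp: simple_graph_def shortcut_def)
  moreover have "connected_graph n E'"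
    using conn_graphsD(4)[OF E] shortcut_connected by (auto simp: connected_graph_iff)
  moreover have "card E' = m"
    using card_shortcut conn_graphsD[OF E] by simp
  ultimately show ?thesis by (simp add: conn_graphs_def)
qed

text \<open>Each far pair with one of its windows is encoded injectively by the shortcut graph and
  three vertices: both ends and \<open>p (Suc i)\<close>. This is the source of
  \<open>n ^ 3\<close>.\<close>

lemma card_far_pairs:
  assumes D: "D = 2 * (M * (2 * q + 3))"
  shows "card (far_pairs n (n + q) D) * ((M - 1) * (M * (2 * q + 3)))
      \<le> card (conn_graphs n (n + q)) * n ^ 3"
proof -
  let ?F = "far_pairs n (n + q) D" and ?C = "conn_graphs n (n + q)"
  let ?X = "SIGMA t:?F. case t of (E, u, v) \<Rightarrow> windows E u v M"
  define \<psi> :: "(nat set set \<times> nat \<times> nat) \<times> nat \<times> nat \<Rightarrow> nat set set \<times> nat \<times> nat \<times> nat" where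
    "\<psi> = (\<lambda>((E, u, v), g, i). (shortcut E (geo E u v) i (i + g), u, v, geo E u v (Suc i)))"
  have "card ?F * ((M - 1) * (M * (2 * q + 3))) = (\<Sum>t\<in>?F. (M - 1) * (M * (2 * q + 3)))" by simp
  also have "\<dots> \<le> (\<Sum>t\<in>?F. card (case t of (E, u, v) \<Rightarrow> windows E u v M))"
    by (rule sum_mono) (use card_windows D in \<open>auto simp: far_pairs_def\<close>)
  also have "\<dots> = card ?X"
    by (subst card_SigmaI) (auto simp: finite_far_pairs)
  also have "\<dots> \<le> card (?C \<times> {1..n} \<times> {1..n} \<times> {1..n})"
  proof (rule card_inj_on_le)
    have decode: "E = unshortcut E' u v c \<and> g = divergence (geo E' c u) (geo E' c v) \<and>
        geo E' c u g = geo E u v i \<and> i \<le> gdist E u v"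
      if x: "((E, u, v), g, i) \<in> ?X" and y: "\<psi> ((E, u, v), g, i) = (E', u', v', c)"
      for E u v g i E' u' v' c
    proof -
      from x have E: "E \<in> ?C" and uv: "u \<in> {1..n}" "v \<in> {1..n}" and w: "(g, i) \<in> windows E u v M"
        by (auto simp: far_pairs_def)
      interpret W: exclusive_window E "geo E u v" "gdist E u v" i "i + g"
        by (rule windows_exclusive_window[OF E uv w])
      note p = geo[OF conn_graphsD(4)[OF E uv]]
      have r: "(x, y) \<in> (adj E)\<^sup>*" if "x \<in> geo E u v ` {..gdist E u v}"
        "y \<in> geo E u v ` {..gdist E u v}" for x y
        using that geo_in_vertices[OF E uv] conn_graphsD(4)[OF E] by auto
      show ?thesis
        using W.unshortcut[OF r] y W.ij W.jd by (auto simp: \<psi>_def p)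
    qed
    show "inj_on \<psi> ?X"
    proof (rule inj_onI)
      fix s t assume s: "s \<in> ?X" and t: "t \<in> ?X" and st: "\<psi> s = \<psi> t"
      obtain E1 u1 v1 g1 i1 where s1: "s = ((E1, u1, v1), g1, i1)" by (metis prod.exhaust)
      obtain E2 u2 v2 g2 i2 where t2: "t = ((E2, u2, v2), g2, i2)" by (metis prod.exhaust)
      have x1: "(E1, u1, v1) \<in> ?F" "(g1, i1) \<in> windows E1 u1 v1 M"
        and x2: "(E2, u2, v2) \<in> ?F" "(g2, i2) \<in> windows E2 u2 v2 M"
        and eq: "\<psi> ((E1, u1, v1), g1, i1) = \<psi> ((E2, u2, v2), g2, i2)"
        using s t st s1 t2 by auto
      obtain E' u v c where y: "\<psi> ((E1, u1, v1), g1, i1) = (E', u, v, c)"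
        by (metis prod_cases4)
      have uv: "u1 = u" "u2 = u" "v1 = v" "v2 = v" using y eq by (auto simp: \<psi>_def)
      note d1 = decode[OF _ y] and d2 = decode[OF _ y[unfolded eq]]
      have E12: "E1 = E2" "g1 = g2" using d1 d2 x1 x2 uv by auto
      have E: "E1 \<in> ?C" "u \<in> {1..n}" "v \<in> {1..n}" using x1 uv by (auto simp: far_pairs_def)
      \<comment> \<open>The start index is recovered last: once the graph and ends agree, the
        geodesics coincide, and a geodesic visits each vertex once.\<close>
      have "geo E1 u v i1 = geo E1 u v i2" "i1 \<le> gdist E1 u v" "i2 \<le> gdist E1 u v"
        using d1 d2 x1 x2 uv E12 by auto
      then have "i1 = i2"
        using inj_onD[OF geodesic_inj[OF geo(3)[OF conn_graphsD(4)[OF E]]]] by auto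
      then show "s = t" using E12 uv s1 t2 by auto
    qed
    show "\<psi> ` ?X \<subseteq> ?C \<times> {1..n} \<times> {1..n} \<times> {1..n}"
    proof (rule image_subsetI)
      fix t assume t: "t \<in> ?X"
      obtain E u v g i where t': "t = ((E, u, v), g, i)" by (metis prod.exhaust)
      from t have w: "(g, i) \<in> windows E u v M" and "(E, u, v) \<in> ?F" by (auto simp: t')
      then have E: "E \<in> ?C" and uv: "u \<in> {1..n}" "v \<in> {1..n}" by (auto simp: far_pairs_def)
      have "Suc i \<le> gdist E u v" using w by (auto simp: windows_def)
      with shortcut_in_conn_graphs[OF E uv w] geo_in_vertices[OF E uv] uv
      show "\<psi> t \<in> ?C \<times> {1..n} \<times> {1..n} \<times> {1..n}" by (simp add: \<psi>_def t')
    qed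
  qed simp
  also have "\<dots> = card ?C * n ^ 3" by (simp add: card_cartesian_product power3_eq_cube)
  finally show ?thesis .
qed

subsection \<open>Adding edges\<close>

text \<open>
  Here \<open>C\<close> closes a cycle with the edge \<open>{a, b}\<close>. Edges are selected greedily outside all previously
  chosen cycles and deleted in reverse order, so that each cycle is intact when its own edge goes.
\<close>

lemma remove_cycle_edges:
  assumes "finite F"
    and "\<And>a b. {a, b} \<in> F \<Longrightarrow> \<exists>C\<subseteq>E. finite C \<and> card C \<le> D \<and> (a, b) \<in> (adj C)\<^sup>* \<and> {a, b} \<notin> C"
    and "\<And>e. e \<in> F \<Longrightarrow> card e = 2"
  shows "\<exists>R\<subseteq>F. card F \<le> Suc D * card R \<and> (\<forall>x y. (x, y) \<in> (adj E)\<^sup>* \<longrightarrow> (x, y) \<in> (adj (E - R))\<^sup>*)"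
  using assms
proof (induction F rule: finite_psubset_induct)
  case (psubset F)
  show ?case
  proof (cases "F = {}")
    case False
    then obtain a b where ab: "{a, b} \<in> F" using psubset.prems(2) by (metis card_2_iff ex_in_conv)
    from psubset.prems(1)[OF ab] obtain C where C: "C \<subseteq> E" "finite C" "card C \<le> D"
      "(a, b) \<in> (adj C)\<^sup>*" "{a, b} \<notin> C" by blast
    \<comment> \<open>Later picks avoid \<open>C\<close>, so it survives in \<open>E - R\<close>;
      one pick costs at most \<open>Suc D\<close> edges of \<open>F\<close>.\<close>
    let ?F = "F - insert {a, b} C"
    have "?F \<subset> F" using ab by blast
    from psubset.IH[OF this] psubset.prems obtain R where R: "R \<subseteq> ?F" "card ?F \<le> Suc D * card R"
      "\<And>x y. (x, y) \<in> (adj E)\<^sup>* \<Longrightarrow> (x, y) \<in> (adj (E - R))\<^sup>*" by (metis (no_types, lifting) DiffD1)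
    let ?R = "insert {a, b} R"
    have finR: "finite R" using R(1) psubset.hyps by (meson finite_Diff finite_subset)
    have "card F \<le> card (?F \<union> insert {a, b} C)"
      by (rule card_mono) (use psubset.hyps C in auto)
    also have "\<dots> \<le> card ?F + card (insert {a, b} C)" by (rule card_Un_le)
    also have "card (insert {a, b} C) \<le> Suc D" using C by simp
    also have "card ?F + Suc D \<le> Suc D * card ?R"
      using R finR by (subst card_insert_disjoint) auto
    finally have "card F \<le> Suc D * card ?R" by simp
    moreover have "(x, y) \<in> (adj (E - ?R))\<^sup>*" if xy: "(x, y) \<in> (adj E)\<^sup>*" for x y
    proof (rule adj_rtrancl_replace[OF R(3)[OF xy]])
      have CR: "C \<subseteq> E - ?R" using C R by auto
      have *: "(a, b) \<in> (adj (E - ?R))\<^sup>*" by (rule adj_rtrancl_mono[OF C(4) CR])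
      fix s t assume st: "{s, t} \<in> E - R"
      show "(s, t) \<in> (adj (E - ?R))\<^sup>*"
      proof (cases "{s, t} = {a, b}")
        case True
        with * adj_rtrancl_commute[OF *] show ?thesis by (auto simp: doubleton_eq_iff)
      next
        case False
        with st have "(s, t) \<in> adj (E - ?R)" by simp
        then show ?thesis by (rule r_into_rtrancl)
      qed
    qed
    moreover have "?R \<subseteq> F" using R ab by auto
    ultimately show ?thesis by blast
  qed auto
qed

lemma card_conn_graph_ge:
  assumes "finite E" "n \<ge> 1" "\<And>v. v \<in> {1..n} \<Longrightarrow> (1, v) \<in> (adj E)\<^sup>*"
  shows "n \<le> Suc (card E)"
  using card_le_roots_plus_edges[of "{1..n}" E "{1}"] assms by auto

text \<open>Deleting the greedily selected edges keeps the graph connected, so at least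
  \<open>n - 1\<close> edges remain and at most \<open>m + 1 - n\<close> were selected.\<close>

lemma card_short_cycle_edges:
  assumes E: "E \<in> conn_graphs n m" and n: "n \<ge> 1"
  shows "card {e \<in> E. \<exists>u v. e = {u, v} \<and> (\<exists>l<D. (u, v) \<in> adj (E - {e}) ^^ l)} \<le> D * (m + 1 - n)"
    (is "card ?F \<le> _")
proof (cases D)
  case (Suc D')
  have finF: "finite ?F" using conn_graphsD(3)[OF E] by simp
  have "\<exists>R\<subseteq>?F. card ?F \<le> Suc D' * card R \<and> (\<forall>x y. (x, y) \<in> (adj E)\<^sup>* \<longrightarrow> (x, y) \<in> (adj (E - R))\<^sup>*)"
  proof (rule remove_cycle_edges[OF finF])
    fix a b assume "{a, b} \<in> ?F"
    then obtain u v l where "{a, b} = {u, v}" "l < D" "(u, v) \<in> adj (E - {{a, b}}) ^^ l" by blast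
    then have uv: "{a, b} = {u, v}" "l \<le> D'" "(u, v) \<in> adj (E - {{a, b}}) ^^ l" using Suc by simp_all
    then have "(a, b) \<in> adj (E - {{a, b}}) ^^ l"
      using adj_relpow_commute[OF uv(3)] by (auto simp: doubleton_eq_iff)
    then obtain f where f: "f 0 = a" "f l = b" "\<And>i. i < l \<Longrightarrow> {f i, f (Suc i)} \<in> E - {{a, b}}"
      unfolding relpow_fun_conv by auto
    let ?C = "(\<lambda>i. {f i, f (Suc i)}) ` {..<l}"
    have "(f 0, f l) \<in> adj ?C ^^ (l - 0)" by (rule walk_relpow) auto
    then have "(f 0, f l) \<in> (adj ?C)\<^sup>*" by (rule relpow_imp_rtrancl)
    then have "(a, b) \<in> (adj ?C)\<^sup>*" using f by simp
    moreover have "card ?C \<le> D'"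
      using card_image_le[of "{..<l}" "\<lambda>i. {f i, f (Suc i)}"] uv(2) by simp
    moreover have "?C \<subseteq> E" using f(3) by blast
    moreover have "{a, b} \<notin> ?C" using f(3) by blast
    moreover have "finite ?C" by simp
    ultimately show "\<exists>C\<subseteq>E. finite C \<and> card C \<le> D' \<and> (a, b) \<in> (adj C)\<^sup>* \<and> {a, b} \<notin> C" by blast
  qed (use conn_graphsD(8)[OF E] in auto)
  then obtain R where R: "R \<subseteq> ?F" "card ?F \<le> D * card R"
    "\<And>x y. (x, y) \<in> (adj E)\<^sup>* \<Longrightarrow> (x, y) \<in> (adj (E - R))\<^sup>*" using Suc by blast
  have "n \<le> Suc (card (E - R))"
    by (rule card_conn_graph_ge) (use R(3) conn_graphsD[OF E] n in auto)
  moreover have RE: "R \<subseteq> E" using R(1) by blast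
  then have "card (E - R) = card E - card R" "card R \<le> card E"
    using conn_graphsD(3)[OF E] finite_subset[OF RE] by (simp_all add: card_Diff_subset card_mono)
  ultimately have "card R \<le> m + 1 - n" using conn_graphsD(2)[OF E] by simp
  then have "D * card R \<le> D * (m + 1 - n)" by (rule mult_le_mono2)
  with R(2) show ?thesis by (rule order_trans)
qed simp

section \<open>Double counting of edge insertions\<close>

lemma card_ordered_pairs_le:
  assumes "finite F"
  shows "finite {(u, v). {u, v} \<in> F}" "card {(u, v). {u, v} \<in> F} \<le> 2 * card F"
proof -
  have 2: "finite {(u, v). {u, v} = e} \<and> card {(u, v). {u, v} = e} \<le> 2" for e :: "'a set"
  proof (cases "\<exists>a b. e = {a, b}")
    case True
    then obtain a b where "e = {a, b}" by blast
    then have "{(u, v). {u, v} = e} \<subseteq> {(a, b), (b, a)}" by (auto simp: doubleton_eq_iff)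
    from finite_subset[OF this] card_mono[OF _ this] have
      "finite {(u, v). {u, v} = e}" "card {(u, v). {u, v} = e} \<le> card {(a, b), (b, a)}" by simp_all
    moreover have "card {x, y} \<le> 2" for x y :: "'a \<times> 'a" by (cases "x = y") auto
    ultimately show ?thesis by (meson le_trans)
  next
    case False
    then have "{(u, v). {u, v} = e} = {}" by blast
    then show ?thesis by (simp only: card.empty finite.emptyI) simp
  qed
  have eq: "{(u, v). {u, v} \<in> F} = (\<Union>e\<in>F. {(u, v). {u, v} = e})" by auto
  show "finite {(u, v). {u, v} \<in> F}" unfolding eq using assms 2 by blast
  have "card {(u, v). {u, v} \<in> F} \<le> (\<Sum>e\<in>F. card {(u, v). {u, v} = e})"
    unfolding eq by (rule card_UN_le[OF assms])
  also have "\<dots> \<le> (\<Sum>e\<in>F. 2)" by (rule sum_mono) (use 2 in auto)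
  finally show "card {(u, v). {u, v} \<in> F} \<le> 2 * card F" by simp
qed

lemma insert_edge_in_conn_graphs:
  assumes H: "H \<in> conn_graphs n m" and uv: "u \<in> {1..n}" "v \<in> {1..n}" "u \<noteq> v" "{u, v} \<notin> H"
  shows "insert {u, v} H \<in> conn_graphs n (Suc m)"
proof -
  have "connected_graph n (insert {u, v} H)"
    unfolding connected_graph_iff
    by (intro ballI adj_rtrancl_mono[OF conn_graphsD(4)[OF H] subset_insertI])
  then show ?thesis
    using uv conn_graphsD(1-3)[OF H] by (simp add: conn_graphs_def simple_graph_def)
qed

definition new_edges ::
  "nat \<Rightarrow> nat \<Rightarrow> (nat set set \<Rightarrow> nat \<Rightarrow> nat \<Rightarrow> bool) \<Rightarrow> (nat set set \<times> nat \<times> nat) set" where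
  "new_edges n m P = {(H, u, v). H \<in> conn_graphs n m \<and> u \<in> {1..n} \<and> v \<in> {1..n} \<and> u \<noteq> v \<and>
     {u, v} \<notin> H \<and> P H u v}"

lemma finite_new_edges: "finite (new_edges n m P)"
  by (rule finite_subset[of _ "conn_graphs n m \<times> {1..n} \<times> {1..n}"]) (auto simp: new_edges_def)

text \<open>The enlarged graph together with the ordered new edge determines \<open>H\<close>; the
  factor 2 counts orientations.\<close>

lemma card_new_edges_le:
  assumes B: "\<And>G. G \<in> conn_graphs n (Suc m) \<Longrightarrow> card {e \<in> G. \<exists>u v. e = {u, v} \<and> P (G - {e}) u v} \<le> B"
  shows "card (new_edges n m P) \<le> card (conn_graphs n (Suc m)) * (2 * B)"
proof -
  let ?F = "\<lambda>G. {e \<in> G. \<exists>u v. e = {u, v} \<and> P (G - {e}) u v}"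
  let ?T = "SIGMA G:conn_graphs n (Suc m). {(u, v). {u, v} \<in> ?F G}"
  have fin: "finite (?F G)" if "G \<in> conn_graphs n (Suc m)" for G
    using conn_graphsD(3)[OF that] by simp
  have "card (new_edges n m P) \<le> card ?T"
  proof (rule card_inj_on_le[where f = "\<lambda>(H, u, v). (insert {u, v} H, u, v)"])
    show "inj_on (\<lambda>(H, u, v). (insert {u, v} H, u, v)) (new_edges n m P)"
      by (auto simp: inj_on_def new_edges_def insert_ident)
    show "(\<lambda>(H, u, v). (insert {u, v} H, u, v)) ` new_edges n m P \<subseteq> ?T"
    proof (rule image_subsetI)
      fix t assume t: "t \<in> new_edges n m P"
      obtain H u v where t': "t = (H, u, v)" by (metis prod.exhaust)
      with t have "insert {u, v} H \<in> conn_graphs n (Suc m)" "insert {u, v} H - {{u, v}} = H" "P H u v"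
        by (auto simp: new_edges_def intro: insert_edge_in_conn_graphs)
      then show "(case t of (H, u, v) \<Rightarrow> (insert {u, v} H, u, v)) \<in> ?T"
        unfolding t' by auto
    qed
    show "finite ?T" by (intro finite_SigmaI finite_conn_graphs card_ordered_pairs_le(1) fin)
  qed
  also have "\<dots> = (\<Sum>G\<in>conn_graphs n (Suc m). card {(u, v). {u, v} \<in> ?F G})"
    by (intro card_SigmaI ballI finite_conn_graphs card_ordered_pairs_le(1) fin)
  also have "\<dots> \<le> (\<Sum>G\<in>conn_graphs n (Suc m). 2 * B)"
    by (intro sum_mono order_trans[OF card_ordered_pairs_le(2)] mult_le_mono2 B fin)
  finally show ?thesis by simp
qed

text \<open>An ordered pair that gives no new edge is diagonal (\<open>n\<close> pairs), adjacent
  (at most \<open>2 * m\<close> pairs) or violates \<open>P\<close>.\<close>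

lemma card_new_edges_ge:
  "card (conn_graphs n m) * n\<^sup>2 \<le> card (new_edges n m P) + card (conn_graphs n m) * (n + 2 * m)
     + card {(H, u, v). H \<in> conn_graphs n m \<and> u \<in> {1..n} \<and> v \<in> {1..n} \<and> \<not> P H u v}"
    (is "_ \<le> _ + _ + card ?N")
proof -
  let ?C = "conn_graphs n m"
  let ?A = "?C \<times> (\<lambda>u. (u, u)) ` {1..n}" and ?B = "SIGMA H:?C. {(u, v). {u, v} \<in> H}"
  let ?all = "?C \<times> {1..n} \<times> {1..n}"
  have finN: "finite ?N" by (rule finite_subset[of _ ?all]) auto
  have finB: "finite ?B" by (rule finite_SigmaI) (auto simp: card_ordered_pairs_le conn_graphsD(3))
  have "card ?C * n\<^sup>2 = card ?all" by (simp add: card_cartesian_product power2_eq_square)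
  also have "\<dots> \<le> card (new_edges n m P \<union> (?A \<union> ?B) \<union> ?N)"
    by (rule card_mono) (use finN finB finite_new_edges in \<open>auto simp: new_edges_def\<close>)
  also have "\<dots> \<le> card (new_edges n m P) + (card ?A + card ?B) + card ?N"
    by (meson add_le_mono card_Un_le le_refl le_trans)
  also have "card ?A = card ?C * n"
    by (simp add: card_cartesian_product card_image inj_on_def)
  also have "card ?B = (\<Sum>H\<in>?C. card {(u, v). {u, v} \<in> H})"
    by (rule card_SigmaI) (auto simp: card_ordered_pairs_le conn_graphsD(3))
  also have "\<dots> \<le> (\<Sum>H\<in>?C. 2 * m)"
    by (rule sum_mono) (metis card_ordered_pairs_le(2) conn_graphsD(2,3))
  finally show ?thesis by (simp add: algebra_simps)
qed

subsection \<open>Removing triangles\<close>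

definition cut_vertex_edges :: "nat set set \<Rightarrow> nat \<Rightarrow> nat \<Rightarrow> nat \<Rightarrow> nat set set" where
  "cut_vertex_edges G x y z = G - {{x, y}, {x, z}}"

definition triangle :: "nat set set \<Rightarrow> nat \<Rightarrow> nat \<Rightarrow> nat \<Rightarrow> bool" where
  "triangle G x y z \<longleftrightarrow> x \<noteq> y \<and> y \<noteq> z \<and> x \<noteq> z \<and> {x, y} \<in> G \<and> {y, z} \<in> G \<and> {x, z} \<in> G"

lemma triangle_rotate: "triangle G x y z \<Longrightarrow> triangle G y z x"
  by (simp add: triangle_def insert_commute eq_commute)

lemma triangle_swap: "triangle G x y z \<Longrightarrow> triangle G y x z"
  by (simp add: triangle_def insert_commute eq_commute)

lemma opposite_edge_in_cut:
  assumes "triangle G x y z"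
  shows "{y, z} \<in> cut_vertex_edges G x y z"
  using assms by (simp add: triangle_def cut_vertex_edges_def doubleton_eq_iff)

lemma card_cut:
  assumes "triangle G x y z" "G \<in> conn_graphs n (Suc (Suc r))"
  shows "card (cut_vertex_edges G x y z) = r"
proof -
  have "{x, y} \<noteq> {x, z}" using assms by (simp add: triangle_def doubleton_eq_iff)
  then show ?thesis
    using assms conn_graphsD(2,3)[OF assms(2)]
    by (simp add: cut_vertex_edges_def triangle_def card_Diff_subset)
qed

text \<open>Every deleted edge ends at \<open>x\<close> and at \<open>y\<close> or \<open>z\<close>,
  and the last two stay joined by the opposite edge; so at most two components arise.\<close>

lemma reach_cut:
  assumes G: "G \<in> conn_graphs n m" and T: "triangle G x y z" and v: "v \<in> {1..n}"
  shows "(x, v) \<in> (adj (cut_vertex_edges G x y z))\<^sup>* \<or> (y, v) \<in> (adj (cut_vertex_edges G x y z))\<^sup>*"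
proof -
  let ?H = "cut_vertex_edges G x y z"
  have "x \<in> {1..n}" using T conn_graphsD(5)[OF G] by (auto simp: triangle_def)
  from conn_graphsD(4)[OF G this v] show ?thesis
  proof induction
    case (step b c)
    show ?case
    proof (cases "{b, c} \<in> ?H")
      case True
      with step.IH show ?thesis by (meson adj_iff rtrancl.rtrancl_into_rtrancl)
    next
      case False
      with step have "{b, c} = {x, y} \<or> {b, c} = {x, z}" by (auto simp: cut_vertex_edges_def)
      then have "c = x \<or> c = y \<or> c = z" by (metis doubleton_eq_iff)
      moreover have "(y, z) \<in> (adj ?H)\<^sup>*" using opposite_edge_in_cut[OF T] by (simp add: r_into_rtrancl)
      ultimately show ?thesis by blast
    qed
  qed simp
qed

lemma connected_graphI_root:
  assumes "\<And>v. v \<in> {1..n} \<Longrightarrow> (x, v) \<in> (adj E)\<^sup>*"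
  shows "connected_graph n E"
  unfolding connected_graph_iff
  by (intro ballI rtrancl_trans[OF adj_rtrancl_commute[OF assms] assms])

lemma cut_in_conn_graphs:
  assumes G: "G \<in> conn_graphs n (Suc (Suc r))" and T: "triangle G x y z"
    and xy: "(x, y) \<in> (adj (cut_vertex_edges G x y z))\<^sup>*"
  shows "cut_vertex_edges G x y z \<in> conn_graphs n r"
proof -
  have "connected_graph n (cut_vertex_edges G x y z)"
    by (rule connected_graphI_root) (use reach_cut[OF G T] rtrancl_trans[OF xy] in blast)
  then show ?thesis
    using card_cut[OF T G] conn_graphsD(1)[OF G]
    by (simp add: conn_graphs_def simple_graph_def cut_vertex_edges_def)
qed

text \<open>By \<open>reach_cut\<close>, a walk from \<open>x\<close> to \<open>y\<close> is all
  that connectivity of the cut graph requires.\<close>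

definition loose_triangle_graphs :: "nat \<Rightarrow> nat \<Rightarrow> nat set set set" where
  "loose_triangle_graphs n m = {G \<in> conn_graphs n m.
     \<exists>x y z. triangle G x y z \<and> (x, y) \<in> (adj (cut_vertex_edges G x y z))\<^sup>*}"

definition tight_triangle_graphs :: "nat \<Rightarrow> nat \<Rightarrow> nat set set set" where
  "tight_triangle_graphs n m = {G \<in> conn_graphs n m. \<not> triangle_free G} - loose_triangle_graphs n m"

lemma uncut:
  assumes "triangle G x y z"
  shows "G = cut_vertex_edges G x y z \<union> (\<lambda>s. {x, s}) ` {y, z}"
  using assms by (auto simp: cut_vertex_edges_def triangle_def)

text \<open>The graph is rebuilt from the cut graph, one of its \<open>r\<close> edges as
  \<open>{y, z}\<close>, and the apex \<open>x\<close>; the order of \<open>y\<close> and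
  \<open>z\<close> is irrelevant.\<close>

lemma card_loose_triangle_graphs:
  "card (loose_triangle_graphs n (Suc (Suc r))) \<le> card (conn_graphs n r) * (r * n)"
proof -
  let ?T = "SIGMA H:conn_graphs n r. H \<times> {1..n}"
  have finT: "finite ?T" by (intro finite_SigmaI finite_cartesian_product) (auto intro: conn_graphsD(3))
  have "loose_triangle_graphs n (Suc (Suc r)) \<subseteq> (\<lambda>(H, e, x). H \<union> (\<lambda>s. {x, s}) ` e) ` ?T"
  proof
    fix G assume "G \<in> loose_triangle_graphs n (Suc (Suc r))"
    then obtain x y z where G: "G \<in> conn_graphs n (Suc (Suc r))" and T: "triangle G x y z"
      and xy: "(x, y) \<in> (adj (cut_vertex_edges G x y z))\<^sup>*"
      by (auto simp: loose_triangle_graphs_def)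
    have "x \<in> {1..n}" using T conn_graphsD(5)[OF G] by (auto simp: triangle_def)
    then have "(cut_vertex_edges G x y z, {y, z}, x) \<in> ?T"
      using cut_in_conn_graphs[OF G T xy] opposite_edge_in_cut[OF T] by blast
    then show "G \<in> (\<lambda>(H, e, x). H \<union> (\<lambda>s. {x, s}) ` e) ` ?T"
      by (rule rev_image_eqI) (use uncut[OF T] in simp)
  qed
  then have "card (loose_triangle_graphs n (Suc (Suc r))) \<le> card ?T"
    by (rule surj_card_le[OF finT])
  also have "\<dots> = (\<Sum>H\<in>conn_graphs n r. card (H \<times> {1..n}))"
    by (rule card_SigmaI) (auto intro: conn_graphsD(3))
  also have "\<dots> = (\<Sum>H\<in>conn_graphs n r. r * n)"
    by (rule sum.cong) (auto simp: card_cartesian_product conn_graphsD(2))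
  finally show ?thesis by simp
qed

lemma cut_commute: "cut_vertex_edges G x y z = cut_vertex_edges G x z y"
  by (auto simp: cut_vertex_edges_def)

lemma tight_triangle_small_side:
  assumes "G \<in> tight_triangle_graphs n m"
  obtains x y z where "triangle G x y z"
    "2 * card {w \<in> {1..n}. (x, w) \<in> (adj (cut_vertex_edges G x y z))\<^sup>*} \<le> n"
proof -
  from assms have G: "G \<in> conn_graphs n m" and "\<not> triangle_free G"
    and tight: "\<And>x y z. triangle G x y z \<Longrightarrow> (x, y) \<notin> (adj (cut_vertex_edges G x y z))\<^sup>*"
    by (auto simp: tight_triangle_graphs_def loose_triangle_graphs_def)
  then obtain x y z where T: "triangle G x y z"
    by (auto simp: triangle_free_def triangle_def)
  let ?X = "{w. (x, w) \<in> (adj (cut_vertex_edges G x y z))\<^sup>*}"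
  let ?Y = "{w. (y, w) \<in> (adj (cut_vertex_edges G y x z))\<^sup>*}"
  \<comment> \<open>A walk on the side of \<open>y\<close> could enter that of \<open>x\<close> only
    along \<open>{x, z}\<close>. It would then reach \<open>z\<close> without the triangle edges at
    \<open>y\<close>, making the triangle loose there.\<close>
  have "w \<notin> ?X" if "(y, w) \<in> (adj (cut_vertex_edges G y x z))\<^sup>*" for w
    using that
  proof induction
    case base
    show ?case using tight[OF T] by simp
  next
    case (step a b)
    show ?case
    proof
      assume b: "b \<in> ?X"
      have ab: "{a, b} \<in> G" "{a, b} \<noteq> {x, y}" using step by (auto simp: cut_vertex_edges_def insert_commute)
      have "{a, b} \<notin> cut_vertex_edges G x y z"
        using b step.IH adj_iff[of b a] by (metis insert_commute mem_Collect_eq rtrancl.rtrancl_into_rtrancl)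
      with ab have "{a, b} = {x, z}" by (auto simp: cut_vertex_edges_def)
      then have "z = a \<or> z = b" by (metis doubleton_eq_iff)
      then have "(y, z) \<in> (adj (cut_vertex_edges G y z x))\<^sup>*"
        using step.hyps unfolding cut_commute[of G y z x] by (metis rtrancl.rtrancl_into_rtrancl)
      then show False using tight[OF triangle_rotate[OF T]] by simp
    qed
  qed
  then have disj: "?X \<inter> ?Y = {}" by blast
  have "card ({w \<in> {1..n}. w \<in> ?X} \<union> {w \<in> {1..n}. w \<in> ?Y}) \<le> card {1..n}"
    by (rule card_mono) auto
  moreover have "card ({w \<in> {1..n}. w \<in> ?X} \<union> {w \<in> {1..n}. w \<in> ?Y}) =
      card {w \<in> {1..n}. w \<in> ?X} + card {w \<in> {1..n}. w \<in> ?Y}"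
    by (rule card_Un_disjoint) (use disj in auto)
  ultimately have "2 * card {w \<in> {1..n}. w \<in> ?X} \<le> n \<or> 2 * card {w \<in> {1..n}. w \<in> ?Y} \<le> n"
    by simp linarith
  then show thesis
    using that[OF T] that[OF triangle_swap[OF T]] by auto
qed

text \<open>A vertex \<open>w\<close> outside the side of \<open>x\<close> lies on the side of
  \<open>y\<close>, so the edge \<open>{x, w}\<close> reunites the two.\<close>

lemma rehang_in_conn_graphs:
  assumes G: "G \<in> conn_graphs n (Suc (Suc r))" and T: "triangle G x y z"
    and w: "w \<in> {1..n}" "(x, w) \<notin> (adj (cut_vertex_edges G x y z))\<^sup>*"
  shows "insert {x, w} (cut_vertex_edges G x y z) \<in> conn_graphs n (Suc r)"
    and "{x, w} \<notin> cut_vertex_edges G x y z"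
proof -
  let ?H = "cut_vertex_edges G x y z"
  let ?H' = "insert {x, w} ?H"
  have mono: "(a, b) \<in> (adj ?H')\<^sup>*" if "(a, b) \<in> (adj ?H)\<^sup>*" for a b
    using that by (rule adj_rtrancl_mono) blast
  have yw: "(y, w) \<in> (adj ?H)\<^sup>*" using reach_cut[OF G T w(1)] w(2) by blast
  have "(x, w) \<in> (adj ?H')\<^sup>*" by (rule r_into_rtrancl) simp
  then have xy: "(x, y) \<in> (adj ?H')\<^sup>*"
    using mono[OF adj_rtrancl_commute[OF yw]] by (rule rtrancl_trans)
  have "connected_graph n ?H'"
    by (rule connected_graphI_root) (use reach_cut[OF G T] mono rtrancl_trans[OF xy] in blast)
  moreover show n: "{x, w} \<notin> ?H" using w(2) by (meson adj_iff r_into_rtrancl)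
  moreover have "x \<noteq> w" using w(2) by blast
  moreover have "x \<in> {1..n}" using T conn_graphsD(5)[OF G] by (auto simp: triangle_def)
  moreover have "finite ?H" "simple_graph n ?H"
    using conn_graphsD(1,3)[OF G] by (simp_all add: cut_vertex_edges_def simple_graph_def)
  ultimately show "?H' \<in> conn_graphs n (Suc r)"
    using w(1) card_cut[OF T G] by (simp add: conn_graphs_def simple_graph_def)
qed

text \<open>Each graph admits at least \<open>n / 2\<close> rehangings. A result \<open>K\<close>
  has \<open>Suc r\<close> edges, and the source is recovered from an ordered edge
  \<open>(x, w)\<close> and an edge \<open>{y, z}\<close> of \<open>K\<close>: at most
  \<open>2 * (Suc r)\<^sup>2\<close> choices.\<close>

lemma card_tight_triangle_graphs:
  "n * card (tight_triangle_graphs n (Suc (Suc r))) \<le> card (conn_graphs n (Suc r)) * (2 * Suc r)\<^sup>2"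
proof -
  let ?S = "tight_triangle_graphs n (Suc (Suc r))"
  have finS: "finite ?S" by (simp add: tight_triangle_graphs_def)
  have SD: "G \<in> conn_graphs n (Suc (Suc r))" if "G \<in> ?S" for G
    using that by (simp add: tight_triangle_graphs_def)
  have "\<forall>G\<in>?S. \<exists>t. case t of (x, y, z) \<Rightarrow> triangle G x y z \<and>
      2 * card {w \<in> {1..n}. (x, w) \<in> (adj (cut_vertex_edges G x y z))\<^sup>*} \<le> n"
  proof
    fix G assume "G \<in> ?S"
    then obtain x y z where "triangle G x y z"
      "2 * card {w \<in> {1..n}. (x, w) \<in> (adj (cut_vertex_edges G x y z))\<^sup>*} \<le> n"
      by (rule tight_triangle_small_side)
    then show "\<exists>t. case t of (x, y, z) \<Rightarrow> triangle G x y z \<and>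
        2 * card {w \<in> {1..n}. (x, w) \<in> (adj (cut_vertex_edges G x y z))\<^sup>*} \<le> n"
      by (intro exI[of _ "(x, y, z)"]) simp
  qed
  from bchoice[OF this] obtain \<tau> where \<tau>: "\<forall>G\<in>?S. case \<tau> G of (x, y, z) \<Rightarrow> triangle G x y z \<and>
      2 * card {w \<in> {1..n}. (x, w) \<in> (adj (cut_vertex_edges G x y z))\<^sup>*} \<le> n" ..
  define X Y Z where XYZ: "X G = fst (\<tau> G)" "Y G = fst (snd (\<tau> G))" "Z G = snd (snd (\<tau> G))" for G
  define H where "H G = cut_vertex_edges G (X G) (Y G) (Z G)" for G
  define W where "W G = {w \<in> {1..n}. (X G, w) \<notin> (adj (H G))\<^sup>*}" for G
  have T: "triangle G (X G) (Y G) (Z G)"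
    and small: "2 * card {w \<in> {1..n}. (X G, w) \<in> (adj (H G))\<^sup>*} \<le> n" if "G \<in> ?S" for G
    using bspec[OF \<tau> that] by (simp_all add: XYZ H_def split: prod.splits)
  have finW: "finite (W G)" for G by (simp add: W_def)
  have W: "n \<le> 2 * card (W G)" if "G \<in> ?S" for G
  proof -
    let ?U = "{w \<in> {1..n}. (X G, w) \<in> (adj (H G))\<^sup>*}"
    have "card {1..n} = card (W G \<union> ?U)" by (rule arg_cong[of _ _ card]) (auto simp: W_def)
    also have "\<dots> = card (W G) + card ?U" by (rule card_Un_disjoint) (auto simp: W_def)
    finally have "n = card (W G) + card ?U" by simp
    with small[OF that] show ?thesis by linarith
  qed
  let ?P = "SIGMA G:?S. W G"
  let ?Q = "SIGMA K:conn_graphs n (Suc r). {(u, v). {u, v} \<in> K} \<times> K"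
  define \<phi> where "\<phi> = (\<lambda>(G, w). (insert {X G, w} (H G), (X G, w), {Y G, Z G}))"
  have "card ?S * n = (\<Sum>G\<in>?S. n)" by simp
  also have "\<dots> \<le> (\<Sum>G\<in>?S. 2 * card (W G))" by (rule sum_mono) (rule W)
  also have "\<dots> = 2 * card ?P" using finS finW by (simp add: sum_distrib_left)
  finally have 1: "card ?S * n \<le> 2 * card ?P" .
  have "card ?P \<le> card ?Q"
  proof (rule card_inj_on_le)
    have dec: "G = (fst (\<phi> (G, w)) - {{X G, w}}) \<union> (\<lambda>s. {X G, s}) ` {Y G, Z G}"
      if "(G, w) \<in> ?P" for G w
    proof -
      have G: "G \<in> ?S" "w \<in> W G" using that by auto
      have "{X G, w} \<notin> H G"
        unfolding H_def by (rule rehang_in_conn_graphs(2)[OF SD[OF G(1)] T[OF G(1)]])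
          (use G(2) in \<open>auto simp: W_def H_def\<close>)
      then have "fst (\<phi> (G, w)) - {{X G, w}} = H G" by (simp add: \<phi>_def)
      then show ?thesis using uncut[OF T[OF G(1)]] by (simp add: H_def)
    qed
    show "inj_on \<phi> ?P"
    proof (rule inj_onI)
      fix s t assume s: "s \<in> ?P" and t: "t \<in> ?P" and st: "\<phi> s = \<phi> t"
      obtain G1 w1 where s1: "s = (G1, w1)" by fastforce
      obtain G2 w2 where t2: "t = (G2, w2)" by fastforce
      have eq: "X G1 = X G2" "w1 = w2" "{Y G1, Z G1} = {Y G2, Z G2}"
        using st unfolding s1 t2 \<phi>_def by simp_all
      have "G1 = G2"
        using dec[of G1 w1] dec[of G2 w2] s t st eq unfolding s1 t2 by metis
      with eq show "s = t" by (simp add: s1 t2)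
    qed
    show "\<phi> ` ?P \<subseteq> ?Q"
    proof (rule image_subsetI)
      fix t assume t: "t \<in> ?P"
      obtain G w where t': "t = (G, w)" by fastforce
      have G: "G \<in> ?S" "w \<in> W G" using t t' by auto
      have "insert {X G, w} (H G) \<in> conn_graphs n (Suc r)"
        unfolding H_def by (rule rehang_in_conn_graphs(1)[OF SD[OF G(1)] T[OF G(1)]])
          (use G(2) in \<open>auto simp: W_def H_def\<close>)
      moreover have "{Y G, Z G} \<in> H G"
        unfolding H_def by (rule opposite_edge_in_cut[OF T[OF G(1)]])
      ultimately show "\<phi> t \<in> ?Q" by (simp add: \<phi>_def t')
    qed
    show "finite ?Q"
      by (intro finite_SigmaI finite_cartesian_product finite_conn_graphs card_ordered_pairs_le(1) conn_graphsD(3))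
  qed
  also have "card ?Q = (\<Sum>K\<in>conn_graphs n (Suc r). card ({(u, v). {u, v} \<in> K} \<times> K))"
    by (intro card_SigmaI ballI finite_cartesian_product finite_conn_graphs card_ordered_pairs_le(1) conn_graphsD(3))
  also have "\<dots> \<le> (\<Sum>K\<in>conn_graphs n (Suc r). 2 * Suc r * Suc r)"
  proof (rule sum_mono)
    fix K assume K: "K \<in> conn_graphs n (Suc r)"
    show "card ({(u, v). {u, v} \<in> K} \<times> K) \<le> 2 * Suc r * Suc r"
      unfolding card_cartesian_product
      using card_ordered_pairs_le(2)[OF conn_graphsD(3)[OF K]] conn_graphsD(2)[OF K]
      by (metis mult_le_mono1)
  qed
  finally have "card ?P \<le> card (conn_graphs n (Suc r)) * (2 * Suc r * Suc r)" by simp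
  with 1 have "card ?S * n \<le> 2 * (card (conn_graphs n (Suc r)) * (2 * Suc r * Suc r))" by linarith
  then show ?thesis by (simp add: power2_eq_square algebra_simps)
qed

subsection \<open>The proportion of graphs with a triangle\<close>

lemma far_pairs_superset:
  "{(H, u, v). H \<in> conn_graphs n m \<and> u \<in> {1..n} \<and> v \<in> {1..n} \<and> \<not> (\<exists>l<D. (u, v) \<in> adj H ^^ l)}
    \<subseteq> far_pairs n m D"
proof -
  have "D \<le> gdist H u v" if "H \<in> conn_graphs n m" "u \<in> {1..n}" "v \<in> {1..n}"
    "\<not> (\<exists>l<D. (u, v) \<in> adj H ^^ l)" for H u v
    using gdist_relpow[OF conn_graphsD(4)[OF that(1-3)]] that(4) by (meson not_le)
  then show ?thesis unfolding far_pairs_def by blast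
qed

text \<open>The condition on \<open>M\<close> makes far pairs at most a quarter of all pairs, and
  \<open>20 \<le> n\<close> does the same for diagonal and adjacent ones. The remaining half closes
  short cycles, whence the factor \<open>4 * D * (k + 1)\<close>, at most
  \<open>48 * M * k\<^sup>2\<close>.\<close>

lemma conn_graphs_ratio:
  assumes k: "k = Suc q" "k \<le> n" and n: "20 \<le> n" and M: "4 * n \<le> (M - 1) * (M * (2 * k + 1))"
  shows "card (conn_graphs n (n + q)) * n\<^sup>2 \<le> 48 * M * k\<^sup>2 * card (conn_graphs n (n + k))"
proof -
  let ?c = "card (conn_graphs n (n + q))" and ?c' = "card (conn_graphs n (n + k))"
  define D where "D = 2 * (M * (2 * q + 3))"
  let ?P = "\<lambda>H u v. \<exists>l<D. (u, v) \<in> adj H ^^ l"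
  let ?f = "card (far_pairs n (n + q) D)"
  have "?f * (4 * n) \<le> ?f * ((M - 1) * (M * (2 * q + 3)))"
  proof (intro mult_le_mono2)
    have "2 * q + 3 = 2 * k + 1" using k by simp
    with M show "4 * n \<le> (M - 1) * (M * (2 * q + 3))" by (simp only:)
  qed
  also have "\<dots> \<le> ?c * n ^ 3" by (rule card_far_pairs[OF D_def])
  finally have "n * (4 * ?f) \<le> n * (?c * n\<^sup>2)"
    by (simp add: power3_eq_cube power2_eq_square algebra_simps)
  then have far: "4 * ?f \<le> ?c * n\<^sup>2" using n by simp
  have "card (new_edges n (n + q) ?P)
      \<le> card (conn_graphs n (Suc (n + q))) * (2 * (D * (Suc (n + q) + 1 - n)))"
    by (rule card_new_edges_le, rule card_short_cycle_edges) (use n in auto)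
  then have near: "card (new_edges n (n + q) ?P) \<le> ?c' * (2 * (D * (k + 1)))"
    using k by simp
  have "?c * n\<^sup>2 \<le> card (new_edges n (n + q) ?P) + ?c * (n + 2 * (n + q)) + ?f"
    using card_new_edges_ge[of n "n + q" ?P]
      card_mono[OF finite_far_pairs far_pairs_superset, of n "n + q" D] by linarith
  moreover have "4 * (?c * (n + 2 * (n + q))) \<le> ?c * n\<^sup>2"
  proof -
    have "4 * (n + 2 * (n + q)) \<le> 20 * n" using k by simp
    also have "\<dots> \<le> n\<^sup>2" using n by (simp add: power2_eq_square)
    finally have "?c * (4 * (n + 2 * (n + q))) \<le> ?c * n\<^sup>2" by (rule mult_le_mono2)
    then show ?thesis by (simp only: ac_simps)
  qed
  ultimately have "?c * n\<^sup>2 \<le> 2 * (?c' * (2 * (D * (k + 1))))" using far near by linarith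
  also have "\<dots> = ?c' * (8 * (M * ((2 * k + 1) * (k + 1))))" by (simp add: D_def k algebra_simps)
  also have "\<dots> \<le> ?c' * (8 * (M * (6 * k\<^sup>2)))"
    by (intro mult_le_mono2) (simp add: k power2_eq_square)
  finally show ?thesis by (simp add: algebra_simps)
qed

text \<open>Here any of the at most \<open>2 * n\<close> edges may be the new one. The resulting
  factor of order \<open>1 / n\<close> pays for the first of the two edges lost at a loose
  triangle.\<close>

lemma conn_graphs_ratio_crude:
  assumes r: "Suc r \<le> 2 * n" and n: "20 \<le> n"
  shows "card (conn_graphs n r) * n \<le> 8 * card (conn_graphs n (Suc r))"
proof -
  let ?c = "card (conn_graphs n r)" and ?c' = "card (conn_graphs n (Suc r))"
  have "card (new_edges n r (\<lambda>_ _ _. True)) \<le> ?c' * (2 * Suc r)"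
  proof (rule card_new_edges_le)
    fix G assume G: "G \<in> conn_graphs n (Suc r)"
    then show "card {e \<in> G. \<exists>u v. e = {u, v} \<and> True} \<le> Suc r"
      using card_mono[OF conn_graphsD(3)[OF G], of "{e \<in> G. \<exists>u v. e = {u, v} \<and> True}"]
        conn_graphsD(2)[OF G] by auto
  qed
  moreover have "{(H, u, v). H \<in> conn_graphs n r \<and> u \<in> {1..n} \<and> v \<in> {1..n} \<and> \<not> True} = {}"
    by blast
  ultimately have "?c * n\<^sup>2 \<le> ?c' * (2 * Suc r) + ?c * (n + 2 * r)"
    using card_new_edges_ge[of n r "\<lambda>_ _ _. True"] by (simp only: card.empty)
  moreover have "?c' * (2 * Suc r) \<le> ?c' * (4 * n)" using r by (intro mult_le_mono2) simp
  moreover have "2 * (?c * (n + 2 * r)) \<le> ?c * n\<^sup>2"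
  proof -
    have "2 * (n + 2 * r) \<le> 20 * n" using r by simp
    also have "\<dots> \<le> n\<^sup>2" using n by (simp add: power2_eq_square)
    finally have "?c * (2 * (n + 2 * r)) \<le> ?c * n\<^sup>2" by (rule mult_le_mono2)
    then show ?thesis by (simp only: ac_simps)
  qed
  ultimately have "?c * n\<^sup>2 \<le> 2 * (?c' * (4 * n))" by linarith
  then have "n * (?c * n) \<le> n * (8 * ?c')" by (simp add: power2_eq_square algebra_simps)
  then show ?thesis using n by simp
qed

text \<open>Loose and tight triangles each contribute \<open>16 * n\<^sup>2\<close> times the count
  with one edge fewer, and \<open>1536 = 32 * 48\<close>.\<close>

lemma card_not_triangle_free:
  assumes k: "1 \<le> k" "k \<le> n" and n: "20 \<le> n" and M: "4 * n \<le> (M - 1) * (M * (2 * k + 1))"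
  shows "card {G \<in> conn_graphs n (n + k). \<not> triangle_free G} * n
    \<le> 1536 * M * k\<^sup>2 * card (conn_graphs n (n + k))"
proof -
  obtain q where q: "k = Suc q" using k by (cases k) auto
  obtain r where r: "n + q = Suc r" using n by (cases "n + q") auto
  let ?c = "card (conn_graphs n (Suc r))"
  let ?L = "loose_triangle_graphs n (Suc (Suc r))" and ?T = "tight_triangle_graphs n (Suc (Suc r))"
  have m: "n + k = Suc (Suc r)" using q r by simp
  have r2: "Suc r \<le> 2 * n" using r q k by simp
  have fin: "finite ?L" "finite ?T" by (simp_all add: tight_triangle_graphs_def loose_triangle_graphs_def)
  have "card {G \<in> conn_graphs n (n + k). \<not> triangle_free G} \<le> card (?L \<union> ?T)"
    by (rule card_mono) (use fin in \<open>auto simp: m tight_triangle_graphs_def\<close>)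
  also have "\<dots> \<le> card ?L + card ?T" by (rule card_Un_le)
  finally have "card {G \<in> conn_graphs n (n + k). \<not> triangle_free G} * n
      \<le> card ?L * n + n * card ?T"
    by (metis add_mult_distrib mult.commute mult_le_mono1)
  moreover have "card ?L * n \<le> 16 * (?c * n\<^sup>2)"
  proof -
    have "card ?L * n \<le> card (conn_graphs n r) * (r * n) * n"
      by (rule mult_le_mono1[OF card_loose_triangle_graphs])
    also have "\<dots> = (card (conn_graphs n r) * n) * (r * n)" by (simp add: algebra_simps)
    also have "\<dots> \<le> (8 * ?c) * (2 * n * n)"
      by (intro mult_le_mono conn_graphs_ratio_crude r2 n) (use r2 in auto)
    finally show ?thesis by (simp add: power2_eq_square algebra_simps)
  qed
  moreover have "n * card ?T \<le> 16 * (?c * n\<^sup>2)"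
  proof -
    have "n * card ?T \<le> ?c * (2 * Suc r)\<^sup>2" by (rule card_tight_triangle_graphs)
    also have "\<dots> \<le> ?c * (4 * n)\<^sup>2" using r2 by (intro mult_le_mono2 power_mono) auto
    finally show ?thesis by (simp add: power2_eq_square algebra_simps)
  qed
  moreover have "?c * n\<^sup>2 \<le> 48 * M * k\<^sup>2 * card (conn_graphs n (n + k))"
    using conn_graphs_ratio[OF q k(2) n M] r by simp
  ultimately show ?thesis by linarith
qed

text \<open>The star centred at \<open>1\<close> is extended to the required size; this keeps the
  denominator of the ratio positive.\<close>

lemma conn_graphs_nonempty:
  assumes "n + k \<le> n choose 2" and n: "1 \<le> n"
  shows "conn_graphs n (n + k) \<noteq> {}"
proof -
  let ?K = "{e. e \<subseteq> {1..n} \<and> card e = 2}"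
  let ?S = "(\<lambda>i. {1, i}) ` {2..n}"
  have SK: "?S \<subseteq> ?K" using n by auto
  have finK: "finite ?K" by simp
  have "card ?S \<le> n + k" using card_image_le[of "{2..n}" "\<lambda>i. {1, i}"] by simp
  moreover have "n + k \<le> card ?K" using assms by (simp add: n_subsets)
  ultimately have "\<exists>E. ?S \<subseteq> E \<and> E \<subseteq> ?K \<and> card E = n + k"
    using exists_subset_between[OF _ _ SK finK] by blast
  then obtain E where E: "?S \<subseteq> E" "E \<subseteq> ?K" "card E = n + k" by blast
  have "(1, v) \<in> (adj E)\<^sup>*" if "v \<in> {1..n}" for v
  proof (cases "v = 1")
    case False
    with that have "{1, v} \<in> ?S" by auto
    with E show ?thesis by (meson adj_iff r_into_rtrancl subsetD)
  qed simp
  then have "connected_graph n E" by (rule connected_graphI_root)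
  with E have "E \<in> conn_graphs n (n + k)" by (auto simp: conn_graphs_def simple_graph_def)
  then show ?thesis by blast
qed

lemma triangle_ratio_bound:
  assumes k: "1 \<le> k" "k \<le> n" and n: "20 \<le> n"
  shows "\<bar>real (num_conn_triangle_free n (n + k)) / real (num_conn n (n + k)) - 1\<bar>
    \<le> 6144 * sqrt (real k ^ 3 / real n)"
proof -
  let ?C = "conn_graphs n (n + k)"
  let ?B = "{G \<in> ?C. \<not> triangle_free G}" and ?A = "{G \<in> ?C. triangle_free G}"
  \<comment> \<open>The order \<open>sqrt (n / k)\<close> is the least for which
    \<open>M\<^sup>2 * k\<close> dominates \<open>n\<close>; \<open>1 \<le> x\<close> absorbs the
    rounding into \<open>4 * x\<close>.\<close>
  define x where "x = sqrt (real n / real k)"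
  define M where "M = nat \<lceil>2 * x\<rceil> + 1"
  have x1: "1 \<le> x" using k by (simp add: x_def)
  have xsq: "x\<^sup>2 = real n / real k" by (simp add: x_def)
  have M1: "2 * x \<le> real (M - 1)" by (simp add: M_def real_nat_ceiling_ge)
  have M2: "real M \<le> 4 * x"
    unfolding M_def using x1 by (simp add: of_nat_nat) linarith
  have "4 * real n = (2 * x)\<^sup>2 * real k" using k by (simp add: power_mult_distrib xsq)
  also have "\<dots> \<le> (real (M - 1))\<^sup>2 * real k"
    using M1 x1 by (intro mult_right_mono power_mono) auto
  also have "\<dots> \<le> real ((M - 1) * (M * (2 * k + 1)))"
  proof -
    have "(M - 1)\<^sup>2 * k \<le> (M - 1) * (M * (2 * k + 1))"
      unfolding power2_eq_square mult.assoc by (intro mult_le_mono order_refl) auto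
    then show ?thesis by (metis of_nat_le_iff of_nat_mult of_nat_power)
  qed
  finally have "4 * n \<le> (M - 1) * (M * (2 * k + 1))"
    by (metis of_nat_le_iff of_nat_mult of_nat_numeral)
  from card_not_triangle_free[OF k n this]
  have "real (card ?B * n) \<le> real (1536 * M * k\<^sup>2 * card ?C)" by (rule of_nat_mono)
  then have 1: "real (card ?B) * real n \<le> 1536 * real M * (real k)\<^sup>2 * real (card ?C)" by simp
  have "2 * (n + k) \<le> n * (n - 1)"
  proof -
    have "2 * (n + k) \<le> n * 4" using k by simp
    also have "\<dots> \<le> n * (n - 1)" using n by (intro mult_le_mono2) simp
    finally show ?thesis .
  qed
  then have "n + k \<le> n choose 2" by (simp add: choose_two)
  then have "?C \<noteq> {}" using n by (intro conn_graphs_nonempty) auto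
  then have pos: "real (card ?C) > 0" by (simp add: card_gt_0_iff)
  have "card ?C = card (?A \<union> ?B)" by (rule arg_cong[of _ _ card]) auto
  also have "\<dots> = card ?A + card ?B" by (rule card_Un_disjoint) auto
  finally have AB: "real (card ?A) = real (card ?C) - real (card ?B)" by simp
  have num: "num_conn_triangle_free n (n + k) = card ?A" "num_conn n (n + k) = card ?C"
    unfolding num_conn_triangle_free_def num_conn_def conn_graphs_def
    by (auto intro: arg_cong[of _ _ card])
  have "\<bar>real (num_conn_triangle_free n (n + k)) / real (num_conn n (n + k)) - 1\<bar>
      = real (card ?B) / real (card ?C)"
  proof -
    have "\<bar>(c - b) / c - 1\<bar> = b / c" if "0 < c" "0 \<le> b" for b c :: real
      using that by (simp add: diff_divide_distrib)
    from this[OF pos] show ?thesis unfolding num AB by simp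
  qed
  also have "\<dots> \<le> 1536 * real M * (real k)\<^sup>2 / real n"
    using 1 pos n by (simp add: field_simps)
  also have "\<dots> \<le> 1536 * (4 * x) * (real k)\<^sup>2 / real n"
    using M2 by (intro divide_right_mono mult_right_mono mult_left_mono) auto
  also have "\<dots> = 6144 * (x * ((real k)\<^sup>2 / real n))" by simp
  also have "x * ((real k)\<^sup>2 / real n) = sqrt (real n / real k * ((real k)\<^sup>2 / real n)\<^sup>2)"
    unfolding x_def real_sqrt_mult by simp
  also have "real n / real k * ((real k)\<^sup>2 / real n)\<^sup>2 = real k ^ 3 / real n"
    using k n by (simp add: field_simps power2_eq_square power3_eq_cube)
  finally show ?thesis .
qed

section \<open>Passage to the limit\<close>

theorem theorem29:
  fixes k :: "nat \<Rightarrow> nat"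
  assumes "filterlim k at_top at_top"
    and "(\<lambda>n. real (k n)) \<in> o(\<lambda>n. real n powr (1 / 3))"
  shows "(\<lambda>n. real (num_conn_triangle_free n (n + k n)) / real (num_conn n (n + k n)))
           \<longlonglongrightarrow> 1"
proof -
  have k1: "eventually (\<lambda>n. 1 \<le> k n) sequentially"
    using assms(1) by (simp add: filterlim_at_top)
  have n20: "eventually (\<lambda>n. 20 \<le> n) sequentially" by (rule eventually_ge_at_top)
  have "eventually (\<lambda>n. norm (real (k n)) \<le> 1 * norm (real n powr (1 / 3))) sequentially"
    by (rule landau_o.smallD[OF assms(2)]) simp
  then have kn: "eventually (\<lambda>n. k n \<le> n) sequentially"
    using n20
  proof eventually_elim
    case (elim n)
    have "real n powr (1 / 3) \<le> real n powr 1" using elim by (intro powr_mono) auto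
    with elim show ?case by simp
  qed
  \<comment> \<open>The cube of this quotient is \<open>k\<^sup>3 / n\<close>, the quantity under
    the root in the error bound.\<close>
  have "((\<lambda>n. real (k n) / real n powr (1 / 3)) \<longlongrightarrow> 0) sequentially"
    by (rule smalloD_tendsto[OF assms(2)])
  then have "((\<lambda>n. 6144 * sqrt ((real (k n) / real n powr (1 / 3)) ^ 3))
      \<longlongrightarrow> 6144 * sqrt (0 ^ 3)) sequentially"
    by (intro tendsto_intros)
  moreover have "eventually (\<lambda>n. 6144 * sqrt ((real (k n) / real n powr (1 / 3)) ^ 3)
      = 6144 * sqrt (real (k n) ^ 3 / real n)) sequentially"
    using n20
  proof eventually_elim
    case (elim n)
    then have "(real n powr (1 / 3)) ^ 3 = real n"
      by (simp add: powr_power)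
    then show ?case by (simp add: power_divide)
  qed
  ultimately have lim: "((\<lambda>n. 6144 * sqrt (real (k n) ^ 3 / real n)) \<longlongrightarrow> 0) sequentially"
    by (simp add: tendsto_cong)
  have "eventually (\<lambda>n.
      norm (real (num_conn_triangle_free n (n + k n)) / real (num_conn n (n + k n)) - 1)
      \<le> norm (6144 * sqrt (real (k n) ^ 3 / real n)) * 1) sequentially"
    using k1 kn n20
  proof eventually_elim
    case (elim n)
    from triangle_ratio_bound[OF elim] show ?case by simp
  qed
  from tendsto_0_le[OF lim this] show ?thesis
    by (rule LIM_zero_cancel)
qed

end
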